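(* Let $A$ be a recursively enumerable set of integers. Then there is a countably generated recursive presentation $Q$ of a group $\overline{Q}$ which is $A$-torsion-free and contains an embedded copy of every countably generated recursively presentable $A$-torsion-free group.
   Context: A countably generated recursive presentation $\langle X \mid R\rangle$ is a group presentation where $X$ is a recursively enumerated set of generators and $R$ is a recursive enumeration of relators; $\overline{P}$ denotes the group it presents. A group is countably generated recursively presentable if it is isomorphic to $\overline{P}$ for some countably generated recursive presentation $P$. For a group $G$ and set of integers $A$, $G$ is $A$-torsion-free if there is no $g \neq e$ in $G$ with $g^{n} = e$ for some $n \in A$. *)

theory Defs
  imports "HOL-Algebra.Algebra" "HOL-Library.Nat_Bijection"
begin

datatype recf = Zero | Succ | Proj nat | Comp recf "recf list" | Prec recf recf | Mn recf

inductive eval :: "recf \<Rightarrow> nat list \<Rightarrow> nat \<Rightarrow> bool" where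
  eval_Zero: "eval Zero xs 0"
| eval_Succ: "eval Succ (x # xs) (Suc x)"
| eval_Proj: "i < length xs \<Longrightarrow> eval (Proj i) xs (xs ! i)"
| eval_Comp: "list_all2 (\<lambda>g y. eval g xs y) gs ys \<Longrightarrow> eval f ys y \<Longrightarrow> eval (Comp f gs) xs y"
| eval_Prec0: "eval f xs y \<Longrightarrow> eval (Prec f g) (0 # xs) y"
| eval_PrecS: "eval (Prec f g) (n # xs) r \<Longrightarrow> eval g (n # r # xs) y \<Longrightarrow> eval (Prec f g) (Suc n # xs) y"
| eval_Mn: "eval f (n # xs) 0 \<Longrightarrow> (\<forall>m<n. \<exists>y. eval f (m # xs) (Suc y)) \<Longrightarrow> eval (Mn f) xs n"

definition re_set :: "nat set \<Rightarrow> bool" where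
  "re_set S \<longleftrightarrow> (\<exists>f. S = {x. \<exists>y. eval f [x] y})"

definition re_int_set :: "int set \<Rightarrow> bool" where
  "re_int_set A \<longleftrightarrow> re_set (int_encode ` A)"

text \<open>A letter (x, b) is the generator x if b = False and its inverse if b = True.\<close>
type_synonym word = "(nat \<times> bool) list"

definition words :: "nat set \<Rightarrow> word set" where
  "words Xs = {w. \<forall>l\<in>set w. fst l \<in> Xs}"

definition word_code :: "word \<Rightarrow> nat" where
  "word_code w = list_encode (map (\<lambda>(x, b). prod_encode (x, if b then 1 else 0)) w)"

inductive peq :: "nat set \<Rightarrow> word set \<Rightarrow> word \<Rightarrow> word \<Rightarrow> bool" for Xs R where
  peq_refl: "peq Xs R w w"
| peq_sym: "peq Xs R u v \<Longrightarrow> peq Xs R v u"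
| peq_trans: "peq Xs R u v \<Longrightarrow> peq Xs R v w \<Longrightarrow> peq Xs R u w"
| peq_cancel: "x \<in> Xs \<Longrightarrow> peq Xs R (u @ [(x, b), (x, \<not> b)] @ v) (u @ v)"
| peq_rel: "r \<in> R \<Longrightarrow> peq Xs R (u @ r @ v) (u @ v)"

definition grel :: "nat set \<Rightarrow> word set \<Rightarrow> (word \<times> word) set" where
  "grel Xs R = {(u, v). u \<in> words Xs \<and> v \<in> words Xs \<and> peq Xs R u v}"

type_synonym presentation = "nat set \<times> word set"

definition presented_group :: "presentation \<Rightarrow> word set monoid" where
  "presented_group P = (case P of (Xs, R) \<Rightarrow>
     \<lparr>carrier = words Xs // grel Xs R,
      monoid.mult = (\<lambda>a b. grel Xs R `` {(SOME u. u \<in> a) @ (SOME v. v \<in> b)}),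
      monoid.one = grel Xs R `` {[]}\<rparr>)"

definition cg_rec_presentation :: "presentation \<Rightarrow> bool" where
  "cg_rec_presentation P \<longleftrightarrow> (case P of (Xs, R) \<Rightarrow>
     re_set Xs \<and> re_set (word_code ` R) \<and> R \<subseteq> words Xs)"

definition cg_rec_presentable :: "('g, 'b) monoid_scheme \<Rightarrow> bool" where
  "cg_rec_presentable G \<longleftrightarrow> (\<exists>P. cg_rec_presentation P \<and> G \<cong> presented_group P)"

definition torsion_free_on :: "int set \<Rightarrow> ('g, 'b) monoid_scheme \<Rightarrow> bool" where
  "torsion_free_on A G \<longleftrightarrow>
     \<not> (\<exists>g\<in>carrier G. g \<noteq> \<one>\<^bsub>G\<^esub> \<and> (\<exists>n\<in>A. g [^]\<^bsub>G\<^esub> n = \<one>\<^bsub>G\<^esub>))"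

definition embeds_into :: "('g, 'b) monoid_scheme \<Rightarrow> ('h, 'c) monoid_scheme \<Rightarrow> bool" where
  "embeds_into G H \<longleftrightarrow> (\<exists>h. h \<in> hom G H \<and> inj_on h (carrier G))"

end

theory Submission
  imports Defs
begin

text \<open>
  Let \<open>W i\<close> be the \<open>i\<close>-th recursively enumerable set. Take generators \<open>(i, x)\<close> for all natural numbers
  \<open>i\<close> and \<open>x\<close>, impose on the \<open>i\<close>-th copy the relators with codes in \<open>W i\<close>, and close under the rule
  that \<open>w\<^sup>n = 1\<close> with \<open>n\<close> in \<open>A\<close> forces \<open>w = 1\<close>. The words that become trivial form a recursively
  enumerable set, and the quotient is \<open>A\<close>-torsion-free by construction. If the \<open>i\<close>-th presentation
  defines an \<open>A\<close>-torsion-free group, then killing all generators outside the \<open>i\<close>-th copy respects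
  every imposed relation, so the \<open>i\<close>-th group is a retract of the quotient and in particular embeds.

  Enumerability rests on the fact that a predicate inductively generated by recursively enumerable
  axioms and two-premise rules is recursively enumerable, because finite derivations can be coded
  by numbers; this is applied to the evaluation relation, which yields a universal function,
  and to the congruence above.
\<close>

section \<open>Recursive functions and recursively enumerable predicates on environments\<close>

text \<open>The first premise has the shape of the induction hypothesis for \<open>Comp\<close>,
  namely uniqueness of each entry of \<open>ys\<close>, so that determinism of an argument list
  follows entry by entry.\<close>

lemma list_all2_fun_unique:
  assumes "list_all2 (\<lambda>g y. \<forall>z. P g z \<longrightarrow> y = z) gs ys" "list_all2 P gs zs"
  shows "ys = zs"
  using assms by (induction gs arbitrary: ys zs) (auto simp: list_all2_Cons1)

lemma eval_deterministic: "eval f xs y \<Longrightarrow> eval f xs z \<Longrightarrow> y = z"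
proof (induction arbitrary: z rule: eval.induct)
  case (eval_Comp xs gs ys f y)
  from eval_Comp.prems obtain zs where zs: "list_all2 (\<lambda>g y. eval g xs y) gs zs" "eval f zs z"
    by (cases rule: eval.cases) auto
  have "list_all2 (\<lambda>g y. \<forall>z. eval g xs z \<longrightarrow> y = z) gs ys"
    using eval_Comp.IH(1) by (rule list_all2_mono) blast
  with zs(1) have "ys = zs" by (rule list_all2_fun_unique[rotated])
  with zs(2) eval_Comp.IH(2) show ?case by blast
next
  case (eval_PrecS f g n xs r y)
  from eval_PrecS.prems obtain r' where "eval (Prec f g) (n # xs) r'" "eval g (n # r' # xs) z"
    by (cases rule: eval.cases) auto
  with eval_PrecS.IH show ?case by blast
next
  case (eval_Mn f n xs)
  from eval_Mn.prems have z: "eval f (z # xs) 0" "\<forall>m<z. \<exists>y. eval f (m # xs) (Suc y)"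
    by (cases rule: eval.cases; auto)+
  \<comment> \<open>Of two distinct results the smaller one is a zero of \<open>f\<close>, whereas
    the larger one requires a positive value there.\<close>
  show ?case
  proof (rule linorder_cases[of n z])
    assume "n < z"
    with z(2) eval_Mn.IH(1) show ?thesis by blast
  next
    assume "z < n"
    with z(1) eval_Mn.IH(2) show ?thesis by blast
  qed
next
  case (eval_Prec0 f xs y g)
  from eval_Prec0.prems have "eval f xs z" by (cases rule: eval.cases) auto
  with eval_Prec0.IH show ?case by blast
qed (auto elim: eval.cases)

text \<open>Functions of several arguments are functions of an environment \<open>e\<close>, the variables being
  \<open>e 0\<close>, \<open>e 1\<close>, and so on. A fresh variable is bound by shifting the environment, so a body \<open>P x e\<close>
  is represented by \<open>P (e 0) (\<lambda>i. e (Suc i))\<close>.\<close>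

definition rec_fn :: "((nat \<Rightarrow> nat) \<Rightarrow> nat) \<Rightarrow> bool" where
  "rec_fn f \<longleftrightarrow> (\<exists>r n. \<forall>e. \<forall>m\<ge>n. eval r (map e [0..<m]) (f e))"

lemma map_upt_Suc_shift: "map e [0..<Suc m] = e 0 # map (\<lambda>i. e (Suc i)) [0..<m]"
  by (simp add: map_upt_Suc del: upt_Suc)

lemma rec_fn_var: "rec_fn (\<lambda>e. e i)"
  unfolding rec_fn_def
proof (intro exI allI impI)
  fix e :: "nat \<Rightarrow> nat" and m assume "Suc i \<le> m"
  then show "eval (Proj i) (map e [0..<m]) (e i)"
    using eval_Proj[of i "map e [0..<m]"] by simp
qed

lemma rec_fn_zero: "rec_fn (\<lambda>e. 0)"
  unfolding rec_fn_def by (blast intro: eval_Zero)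

text \<open>All infinitely many variables are replaced at once, but the program for \<open>F\<close>
  can be run on a prefix of fixed length \<open>n\<close>, so only \<open>n\<close> of the replacing
  programs are composed.\<close>

lemma rec_fn_subst:
  assumes F: "rec_fn F" and g: "\<And>i. rec_fn (g i)"
  shows "rec_fn (\<lambda>e. F (\<lambda>i. g i e))"
proof -
  obtain r n where r: "\<And>e m. n \<le> m \<Longrightarrow> eval r (map e [0..<m]) (F e)"
    using F unfolding rec_fn_def by blast
  have "\<forall>i. \<exists>s k. \<forall>e. \<forall>m\<ge>k. eval s (map e [0..<m]) (g i e)"
    using g unfolding rec_fn_def by blast
  then obtain s k where s: "\<And>i e m. k i \<le> m \<Longrightarrow> eval (s i) (map e [0..<m]) (g i e)"
    by metis
  \<comment> \<open>The sum of the finitely many thresholds \<open>k i\<close> serves as a common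
    upper bound for them.\<close>
  have "eval (Comp r (map s [0..<n])) (map e [0..<m]) (F (\<lambda>i. g i e))" if m: "m \<ge> (\<Sum>i<n. k i)" for e m
  proof (rule eval_Comp)
    have "k i \<le> m" if "i < n" for i
      using member_le_sum[of i "{..<n}" k] that m by simp
    then show "list_all2 (\<lambda>g y. eval g (map e [0..<m]) y) (map s [0..<n]) (map (\<lambda>i. g i e) [0..<n])"
      by (auto simp: list_all2_conv_all_nth s)
    show "eval r (map (\<lambda>i. g i e) [0..<n]) (F (\<lambda>i. g i e))"
      using r[of n] by simp
  qed
  then show ?thesis unfolding rec_fn_def by blast
qed

lemma rec_fn_subst1:
  assumes "rec_fn (\<lambda>e. F (e 0))" "rec_fn f"
  shows "rec_fn (\<lambda>e. F (f e))"
  using rec_fn_subst[OF assms(1), of "\<lambda>_. f"] assms(2) by simp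

lemma rec_fn_shift: "rec_fn f \<Longrightarrow> rec_fn (\<lambda>e. f (\<lambda>i. e (Suc i)))"
  using rec_fn_subst[of f "\<lambda>i e. e (Suc i)"] by (simp add: rec_fn_var)

lemma rec_fn_Suc:
  assumes "rec_fn f"
  shows "rec_fn (\<lambda>e. Suc (f e))"
proof (rule rec_fn_subst1[OF _ assms])
  have "eval Succ (map e [0..<m]) (Suc (e 0))" if "Suc 0 \<le> m" for e m
    using that by (cases m) (auto simp: map_upt_Suc_shift eval_Succ simp del: upt_Suc)
  then show "rec_fn (\<lambda>e. Suc (e 0))" unfolding rec_fn_def by blast
qed

lemma rec_fn_const: "rec_fn (\<lambda>e. c)"
  by (induction c) (auto intro: rec_fn_zero rec_fn_Suc)

lemma rec_fn_rec_nat: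
  assumes f: "rec_fn f" and g: "rec_fn (\<lambda>e. g (e 0) (e (Suc 0)) (\<lambda>i. e (Suc (Suc i))))" and h: "rec_fn h"
  shows "rec_fn (\<lambda>e. rec_nat (f e) (\<lambda>k r. g k r e) (h e))"
proof -
  obtain rf nf where rf: "\<And>e m. nf \<le> m \<Longrightarrow> eval rf (map e [0..<m]) (f e)"
    using f unfolding rec_fn_def by blast
  obtain rg ng where rg: "\<And>e m. ng \<le> m \<Longrightarrow>
      eval rg (map e [0..<m]) (g (e 0) (e (Suc 0)) (\<lambda>i. e (Suc (Suc i))))"
    using g unfolding rec_fn_def by blast
  have Prec: "eval (Prec rf rg) (k # map e [0..<m]) (rec_nat (f e) (\<lambda>k r. g k r e) k)"
    if m: "nf + ng \<le> m" for e m k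
  proof (induction k)
    case 0
    show ?case using rf[of m e] m by (auto intro: eval_Prec0)
  next
    case (Suc k)
    let ?r = "rec_nat (f e) (\<lambda>k r. g k r e) k"
    \<comment> \<open>The environment \<open>e\<close> with \<open>k\<close> and \<open>?r\<close>
      put in front is \<open>case_nat k (case_nat ?r e)\<close>; its prefix is two entries
      longer.\<close>
    have "eval rg (k # ?r # map e [0..<m]) (g k ?r e)"
      using rg[of "Suc (Suc m)" "case_nat k (case_nat ?r e)"] m
      by (simp add: map_upt_Suc_shift del: upt_Suc)
    with Suc show ?case by (auto intro: eval_PrecS)
  qed
  have "eval (Prec rf rg) (map e [0..<m])
      (rec_nat (f (\<lambda>i. e (Suc i))) (\<lambda>k r. g k r (\<lambda>i. e (Suc i))) (e 0))"
    if "Suc (nf + ng) \<le> m" for e m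
    using that Prec[of "m - 1" "e 0" "\<lambda>i. e (Suc i)"]
    by (cases m) (auto simp: map_upt_Suc_shift simp del: upt_Suc)
  then have "rec_fn (\<lambda>e. rec_nat (f (\<lambda>i. e (Suc i))) (\<lambda>k r. g k r (\<lambda>i. e (Suc i))) (e 0))"
    unfolding rec_fn_def by blast
  \<comment> \<open>Variable \<open>0\<close> becomes \<open>h e\<close> and variable
    \<open>Suc i\<close> becomes \<open>e i\<close>, which undoes the shift.\<close>
  from rec_fn_subst[OF this, of "case_nat h (\<lambda>i e. e i)"] h show ?thesis
    by (simp split: nat.split add: rec_fn_var)
qed

text \<open>The existence hypothesis keeps the search total, as a \<open>rec_fn\<close> must return
  a value on every environment.\<close>

lemma rec_fn_Least:
  assumes F: "rec_fn (\<lambda>e. F (e 0) (\<lambda>i. e (Suc i)))" and ex: "\<And>e. \<exists>k. F k e = 0"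
  shows "rec_fn (\<lambda>e. LEAST k. F k e = 0)"
proof -
  obtain r n where r: "\<And>e m. n \<le> m \<Longrightarrow> eval r (map e [0..<m]) (F (e 0) (\<lambda>i. e (Suc i)))"
    using F unfolding rec_fn_def by blast
  have r': "eval r (k # map e [0..<m]) (F k e)" if "n \<le> m" for e m k
    using r[of "Suc m" "case_nat k e"] that by (simp add: map_upt_Suc_shift del: upt_Suc)
  have "eval (Mn r) (map e [0..<m]) (LEAST k. F k e = 0)" if m: "n \<le> m" for e m
  proof (rule eval_Mn)
    have "F (LEAST k. F k e = 0) e = 0"
      using ex[of e] by (rule LeastI_ex)
    then show "eval r ((LEAST k. F k e = 0) # map e [0..<m]) 0"
      using r'[OF m, of "LEAST k. F k e = 0" e] by simp
    show "\<forall>k<LEAST k. F k e = 0. \<exists>y. eval r (k # map e [0..<m]) (Suc y)"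
    proof (intro allI impI)
      fix k assume "k < (LEAST k. F k e = 0)"
      then have "F k e \<noteq> 0" by (rule not_less_Least)
      then show "\<exists>y. eval r (k # map e [0..<m]) (Suc y)"
        using r'[OF m, of k e] by (metis not0_implies_Suc)
    qed
  qed
  then show ?thesis unfolding rec_fn_def by blast
qed

section \<open>Decidable predicates\<close>

text \<open>Truth is represented by \<open>0\<close>, because \<open>Mn\<close> searches for a
  zero.\<close>

definition dec :: "((nat \<Rightarrow> nat) \<Rightarrow> bool) \<Rightarrow> bool" where
  "dec P \<longleftrightarrow> rec_fn (\<lambda>e. if P e then 0 else 1)"

text \<open>A case distinction is a primitive recursion over the truth value: the base case returns
  \<open>f\<close>, and the step discards the previous value and returns \<open>g\<close>.\<close>

lemma rec_fn_If:
  assumes "dec P" "rec_fn f" "rec_fn g"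
  shows "rec_fn (\<lambda>e. if P e then f e else g e)"
proof -
  have g: "rec_fn (\<lambda>e. g (\<lambda>i. e (Suc (Suc i))))"
    using rec_fn_shift[OF rec_fn_shift[OF assms(3)]] .
  have "(\<lambda>e. if P e then f e else g e) = (\<lambda>e. rec_nat (f e) (\<lambda>k r. g e) (if P e then 0 else 1))"
    by auto
  then show ?thesis
    using rec_fn_rec_nat[OF assms(2) g assms(1)[unfolded dec_def]] by simp
qed

lemma dec_eq_0: "rec_fn f \<Longrightarrow> dec (\<lambda>e. f e = 0)"
proof -
  assume f: "rec_fn f"
  have "(\<lambda>e. if f e = 0 then 0 else 1::nat) = (\<lambda>e. rec_nat 0 (\<lambda>k r. 1) (f e))"
    by (auto simp: fun_eq_iff gr0_conv_Suc)
  then show ?thesis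
    unfolding dec_def by (simp only:) (intro rec_fn_rec_nat rec_fn_const f)
qed

lemma dec_const: "dec (\<lambda>e. P)"
  unfolding dec_def by (rule rec_fn_const)

lemma dec_if: "dec P \<Longrightarrow> dec Q \<Longrightarrow> dec R \<Longrightarrow> dec (\<lambda>e. if P e then Q e else R e)"
proof -
  assume *: "dec P" "dec Q" "dec R"
  have "(\<lambda>e. if (if P e then Q e else R e) then 0 else 1::nat) =
      (\<lambda>e. if P e then (if Q e then 0 else 1) else (if R e then 0 else 1))"
    by auto
  then show ?thesis
    using rec_fn_If[OF *(1) *(2,3)[unfolded dec_def]] unfolding dec_def by simp
qed

lemma dec_not: "dec P \<Longrightarrow> dec (\<lambda>e. \<not> P e)"
  using dec_if[of P "\<lambda>_. False" "\<lambda>_. True"] by (simp add: dec_const if_bool_eq_conj)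

lemma dec_conj: "dec P \<Longrightarrow> dec Q \<Longrightarrow> dec (\<lambda>e. P e \<and> Q e)"
  using dec_if[of P Q "\<lambda>_. False"] by (simp add: dec_const if_bool_eq_disj)

lemma dec_disj: "dec P \<Longrightarrow> dec Q \<Longrightarrow> dec (\<lambda>e. P e \<or> Q e)"
  using dec_not[OF dec_conj[OF dec_not dec_not]] by simp

lemma dec_subst: "dec P \<Longrightarrow> (\<And>i. rec_fn (g i)) \<Longrightarrow> dec (\<lambda>e. P (\<lambda>i. g i e))"
  unfolding dec_def by (rule rec_fn_subst[of "\<lambda>e. if P e then 0 else 1" g])

lemma rec_fn_add: "rec_fn f \<Longrightarrow> rec_fn g \<Longrightarrow> rec_fn (\<lambda>e. f e + g e)"
proof -
  assume fg: "rec_fn f" "rec_fn g"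
  have "rec_nat a (\<lambda>k r. Suc r) b = a + b" for a b by (induction b) auto
  moreover have "rec_fn (\<lambda>e. rec_nat (f e) (\<lambda>k r. Suc r) (g e))"
    by (intro rec_fn_rec_nat rec_fn_Suc rec_fn_var fg)
  ultimately show ?thesis by simp
qed

lemma rec_fn_pred: "rec_fn f \<Longrightarrow> rec_fn (\<lambda>e. f e - Suc 0)"
proof -
  assume f: "rec_fn f"
  have "rec_nat 0 (\<lambda>k r. k) b = b - Suc 0" for b by (cases b) auto
  moreover have "rec_fn (\<lambda>e. rec_nat 0 (\<lambda>k r. k) (f e))"
    by (intro rec_fn_rec_nat rec_fn_zero rec_fn_var f)
  ultimately show ?thesis by simp
qed

lemma rec_fn_diff: "rec_fn f \<Longrightarrow> rec_fn g \<Longrightarrow> rec_fn (\<lambda>e. f e - g e)"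
proof -
  assume fg: "rec_fn f" "rec_fn g"
  have "rec_nat a (\<lambda>k r. r - Suc 0) b = a - b" for a b by (induction b) auto
  moreover have "rec_fn (\<lambda>e. rec_nat (f e) (\<lambda>k r. r - Suc 0) (g e))"
    by (intro rec_fn_rec_nat rec_fn_pred rec_fn_var fg)
  ultimately show ?thesis by simp
qed

lemma dec_le: "rec_fn f \<Longrightarrow> rec_fn g \<Longrightarrow> dec (\<lambda>e. f e \<le> g e)"
  using dec_eq_0[OF rec_fn_diff] by simp

lemma dec_less: "rec_fn f \<Longrightarrow> rec_fn g \<Longrightarrow> dec (\<lambda>e. f e < g e)"
  using dec_not[OF dec_le[of g f]] by (simp add: not_le)

lemma dec_eq: "rec_fn f \<Longrightarrow> rec_fn g \<Longrightarrow> dec (\<lambda>e. f e = g e)"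
  using dec_conj[OF dec_le[of f g] dec_le[of g f]] by (simp add: eq_iff)

lemma rec_fn_LeastP:
  assumes "dec (\<lambda>e. P (e 0) (\<lambda>i. e (Suc i)))" "\<And>e. \<exists>k. P k e"
  shows "rec_fn (\<lambda>e. LEAST k. P k e)"
proof -
  have *: "(\<lambda>k. (if P k e then 0 else 1) = (0::nat)) = (\<lambda>k. P k e)" for e
    by auto
  show ?thesis
    using rec_fn_Least[of "\<lambda>k e. if P k e then 0 else 1"] assms unfolding dec_def * by blast
qed

text \<open>Admitting \<open>b e\<close> as a candidate that always succeeds makes the search total;
  it stops strictly below \<open>b e\<close> exactly if there is a genuine witness.\<close>

lemma dec_bex_less:
  assumes b: "rec_fn b" and P: "dec (\<lambda>e. P (e 0) (\<lambda>i. e (Suc i)))"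
  shows "dec (\<lambda>e. \<exists>k<b e. P k e)"
proof -
  have "(\<exists>k<b e. P k e) \<longleftrightarrow> (LEAST k. P k e \<or> k = b e) < b e" for e
  proof
    assume "\<exists>k<b e. P k e"
    then obtain k where "k < b e" "P k e" by blast
    then show "(LEAST k. P k e \<or> k = b e) < b e"
      by (metis (mono_tags, lifting) Least_le le_less_trans)
  next
    assume less: "(LEAST k. P k e \<or> k = b e) < b e"
    have "P (LEAST k. P k e \<or> k = b e) e \<or> (LEAST k. P k e \<or> k = b e) = b e"
      by (rule LeastI[of "\<lambda>k. P k e \<or> k = b e" "b e"]) simp
    with less show "\<exists>k<b e. P k e" by auto
  qed
  moreover have "dec (\<lambda>e. (LEAST k. P k e \<or> k = b e) < b e)"
    by (intro dec_less rec_fn_LeastP dec_disj P dec_eq rec_fn_var rec_fn_shift b) auto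
  ultimately show ?thesis by simp
qed

lemma dec_ball_less:
  assumes "rec_fn b" "dec (\<lambda>e. P (e 0) (\<lambda>i. e (Suc i)))"
  shows "dec (\<lambda>e. \<forall>k<b e. P k e)"
  using dec_not[OF dec_bex_less[OF assms(1) dec_not[OF assms(2)]]] by simp

section \<open>The pairing function and its inverses are computable\<close>

lemma rec_fn_triangle: "rec_fn f \<Longrightarrow> rec_fn (\<lambda>e. triangle (f e))"
proof -
  assume f: "rec_fn f"
  have "rec_nat 0 (\<lambda>k r. r + Suc k) b = triangle b" for b by (induction b) auto
  moreover have "rec_fn (\<lambda>e. rec_nat 0 (\<lambda>k r. r + Suc k) (f e))"
    by (intro rec_fn_rec_nat rec_fn_zero rec_fn_add rec_fn_Suc rec_fn_var f)
  ultimately show ?thesis by simp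
qed

lemma rec_fn_prod_encode: "rec_fn f \<Longrightarrow> rec_fn g \<Longrightarrow> rec_fn (\<lambda>e. prod_encode (f e, g e))"
  by (simp add: prod_encode_def rec_fn_add rec_fn_triangle)

text \<open>The component is found by search. The other component is bounded by the code itself, so
  the condition searched for is decidable.\<close>

lemma rec_fn_fst_prod_decode: "rec_fn f \<Longrightarrow> rec_fn (\<lambda>e. fst (prod_decode (f e)))"
proof -
  assume f: "rec_fn f"
  have eq: "fst (prod_decode z) = (LEAST a. \<exists>b<Suc z. prod_encode (a, b) = z)" for z
  proof (cases "prod_decode z")
    case (Pair a b)
    then have z: "z = prod_encode (a, b)" by (metis prod_decode_inverse)
    show ?thesis
      by (rule sym, rule Least_equality)
        (auto simp: z prod_encode_eq le_prod_encode_2 less_Suc_eq_le)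
  qed
  show ?thesis unfolding eq
  proof (rule rec_fn_LeastP)
    show "dec (\<lambda>e. \<exists>b<Suc (f (\<lambda>i. e (Suc i))). prod_encode (e 0, b) = f (\<lambda>i. e (Suc i)))"
      by (intro dec_bex_less dec_eq rec_fn_Suc rec_fn_prod_encode rec_fn_var rec_fn_shift f)
  next
    fix e
    show "\<exists>a. \<exists>b<Suc (f e). prod_encode (a, b) = f e"
      using prod_decode_inverse[of "f e"] le_prod_encode_2
      by (metis less_Suc_eq_le surj_pair)
  qed
qed

lemma rec_fn_snd_prod_decode: "rec_fn f \<Longrightarrow> rec_fn (\<lambda>e. snd (prod_decode (f e)))"
proof -
  assume f: "rec_fn f"
  have eq: "snd (prod_decode z) = (LEAST b. prod_encode (fst (prod_decode z), b) = z)" for z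
  proof (cases "prod_decode z")
    case (Pair a b)
    then have z: "z = prod_encode (a, b)" by (metis prod_decode_inverse)
    show ?thesis
      by (rule sym, rule Least_equality) (auto simp: z prod_encode_eq)
  qed
  show ?thesis unfolding eq
  proof (rule rec_fn_LeastP)
    show "dec (\<lambda>e. prod_encode (fst (prod_decode (f (\<lambda>i. e (Suc i)))), e 0) = f (\<lambda>i. e (Suc i)))"
      by (intro dec_eq rec_fn_prod_encode rec_fn_fst_prod_decode rec_fn_var rec_fn_shift f)
  next
    fix e
    show "\<exists>b. prod_encode (fst (prod_decode (f e)), b) = f e"
      by (metis prod_decode_inverse prod.collapse)
  qed
qed

section \<open>Recursively enumerable predicates\<close>

text \<open>As projections of decidable predicates, these are easily closed under conjunction,
  disjunction and existential quantification; \<open>re_set_Collect\<close> leads back to domains of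
  programs.\<close>

definition re :: "((nat \<Rightarrow> nat) \<Rightarrow> bool) \<Rightarrow> bool" where
  "re P \<longleftrightarrow> (\<exists>D. dec D \<and> (\<forall>e. P e \<longleftrightarrow> (\<exists>w. D (case_nat w e))))"

lemma reI:
  assumes "dec (\<lambda>e. D (e 0) (\<lambda>i. e (Suc i)))" "\<And>e. P e \<longleftrightarrow> (\<exists>w. D w e)"
  shows "re P"
  unfolding re_def using assms by (intro exI[of _ "\<lambda>e. D (e 0) (\<lambda>i. e (Suc i))"]) simp

lemma reE:
  assumes "re P"
  obtains D where "dec (\<lambda>e. D (e 0) (\<lambda>i. e (Suc i)))" "\<And>e. P e \<longleftrightarrow> (\<exists>w. D w e)"
proof -
  obtain D where D: "dec D" "\<And>e. P e \<longleftrightarrow> (\<exists>w. D (case_nat w e))"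
    using assms unfolding re_def by blast
  have "case_nat (e 0) (\<lambda>i. e (Suc i)) = e" for e :: "nat \<Rightarrow> nat"
    by (auto split: nat.split)
  with D show thesis by (intro that[of "\<lambda>w e. D (case_nat w e)"]) auto
qed

lemma dec_subst_witness:
  assumes "dec (\<lambda>e. D (e 0) (\<lambda>i. e (Suc i)))" "rec_fn f" "\<And>i. rec_fn (g i)"
  shows "dec (\<lambda>e. D (f e) (\<lambda>i. g i e))"
  using dec_subst[OF assms(1), of "case_nat f g"] assms(2,3) by (simp split: nat.split)

lemma re_dec: "dec P \<Longrightarrow> re P"
  using dec_subst[of P "\<lambda>i e. e (Suc i)"] by (intro reI[of "\<lambda>w e. P e"]) (auto intro: rec_fn_var)

lemma re_subst:
  assumes "re P" "\<And>i. rec_fn (g i)"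
  shows "re (\<lambda>e. P (\<lambda>i. g i e))"
proof -
  from assms(1) obtain D where D: "dec (\<lambda>e. D (e 0) (\<lambda>i. e (Suc i)))"
    "\<And>e. P e \<longleftrightarrow> (\<exists>w. D w e)" by (rule reE) (rule that)
  show ?thesis
    by (rule reI[of "\<lambda>w e. D w (\<lambda>i. g i e)"], intro dec_subst_witness[OF D(1)] rec_fn_var rec_fn_shift assms) (simp add: D(2))
qed

text \<open>The quantified value and the witness are merged into one witness by pairing.\<close>

lemma re_ex:
  assumes "re (\<lambda>e. P (e 0) (\<lambda>i. e (Suc i)))"
  shows "re (\<lambda>e. \<exists>x. P x e)"
proof -
  from assms obtain D where D: "dec (\<lambda>e. D (e 0) (\<lambda>i. e (Suc i)))"
    "\<And>e. P (e 0) (\<lambda>i. e (Suc i)) \<longleftrightarrow> (\<exists>w. D w e)" by (rule reE) (rule that)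
  have P: "P x e \<longleftrightarrow> (\<exists>w. D w (case_nat x e))" for x e
    using D(2)[of "case_nat x e"] by simp
  show ?thesis
  proof (rule reI)
    have "dec (\<lambda>e. D (snd (prod_decode (e 0)))
        (\<lambda>j. (case j of 0 \<Rightarrow> \<lambda>e. fst (prod_decode (e 0)) | Suc i \<Rightarrow> (\<lambda>e. e (Suc i))) e))"
      by (rule dec_subst_witness[OF D(1)]) (auto intro: rec_fn_var rec_fn_fst_prod_decode rec_fn_snd_prod_decode split: nat.split)
    moreover have "(\<lambda>j. (case j of 0 \<Rightarrow> \<lambda>e. fst (prod_decode (e 0)) | Suc i \<Rightarrow> (\<lambda>e. e (Suc i))) e)
        = case_nat (fst (prod_decode (e 0))) (\<lambda>i. e (Suc i))" for e :: "nat \<Rightarrow> nat"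
      by (auto split: nat.split)
    ultimately show "dec (\<lambda>e. D (snd (prod_decode (e 0))) (case_nat (fst (prod_decode (e 0))) (\<lambda>i. e (Suc i))))"
      by simp
    show "(\<exists>x. P x e) \<longleftrightarrow> (\<exists>w. D (snd (prod_decode w)) (case_nat (fst (prod_decode w)) e))" for e
      unfolding P by (metis fst_conv snd_conv prod_encode_inverse)
  qed
qed

lemma re_conj:
  assumes "re P" "re Q"
  shows "re (\<lambda>e. P e \<and> Q e)"
proof -
  from assms(1) obtain D where D: "dec (\<lambda>e. D (e 0) (\<lambda>i. e (Suc i)))"
    "\<And>e. P e \<longleftrightarrow> (\<exists>w. D w e)" by (rule reE) (rule that)
  from assms(2) obtain E where E: "dec (\<lambda>e. E (e 0) (\<lambda>i. e (Suc i)))"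
    "\<And>e. Q e \<longleftrightarrow> (\<exists>w. E w e)" by (rule reE) (rule that)
  have "re (\<lambda>e. \<exists>v w. D v e \<and> E w e)"
    by (intro re_ex re_dec dec_conj dec_subst_witness[OF D(1)] dec_subst_witness[OF E(1)] rec_fn_var)
  then show ?thesis by (simp add: D(2) E(2))
qed

lemma re_disj:
  assumes "re P" "re Q"
  shows "re (\<lambda>e. P e \<or> Q e)"
proof -
  from assms(1) obtain D where D: "dec (\<lambda>e. D (e 0) (\<lambda>i. e (Suc i)))"
    "\<And>e. P e \<longleftrightarrow> (\<exists>w. D w e)" by (rule reE) (rule that)
  from assms(2) obtain E where E: "dec (\<lambda>e. E (e 0) (\<lambda>i. e (Suc i)))"
    "\<And>e. Q e \<longleftrightarrow> (\<exists>w. E w e)" by (rule reE) (rule that)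
  have "re (\<lambda>e. \<exists>v w. D v e \<or> E w e)"
    by (intro re_ex re_dec dec_disj dec_subst_witness[OF D(1)] dec_subst_witness[OF E(1)] rec_fn_var)
  then show ?thesis by (simp add: D(2) E(2))
qed

lemma re_subst1: "re (\<lambda>e. P (e 0)) \<Longrightarrow> rec_fn f \<Longrightarrow> re (\<lambda>e. P (f e))"
  using re_subst[of "\<lambda>e. P (e 0)" "\<lambda>_. f"] by simp

lemma re_subst2:
  assumes "re (\<lambda>e. P (e 0) (e (Suc 0)))" "rec_fn f" "rec_fn g"
  shows "re (\<lambda>e. P (f e) (g e))"
  using re_subst[OF assms(1), of "case_nat f (\<lambda>_. g)"] assms(2,3) by (simp split: nat.split)

text \<open>A program that uses \<open>Mn\<close> to search for the least witness halts exactly on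
  the members.\<close>

lemma re_set_Collect:
  assumes "re (\<lambda>e. P (e 0))"
  shows "re_set {x. P x}"
proof -
  from assms obtain D where D: "dec (\<lambda>e. D (e 0) (\<lambda>i. e (Suc i)))"
    "\<And>e. P (e 0) \<longleftrightarrow> (\<exists>w. D w e)" by (rule reE) (rule that)
  from D(1) obtain r n where r: "\<And>e m. n \<le> m \<Longrightarrow>
      eval r (map e [0..<m]) (if D (e 0) (\<lambda>i. e (Suc i)) then 0 else 1)"
    unfolding dec_def rec_fn_def by blast
  \<comment> \<open>The program \<open>r\<close> is guaranteed to work only on at least
    \<open>n\<close> variables, so the single input is padded with \<open>n\<close> zeros. As
    \<open>P\<close> reads only the input, the padding leaves its truth value unchanged.\<close>
  let ?e = "\<lambda>x. case_nat x (\<lambda>_. 0::nat)" and ?args = "Proj 0 # replicate n Zero"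
  have eval_r: "eval r (w # x # replicate n 0) (if D w (?e x) then 0 else 1)" for w x
    using r[of "Suc (Suc n)" "case_nat w (?e x)"]
    by (simp add: map_upt_Suc_shift map_replicate_trivial del: upt_Suc)
  have args: "list_all2 (\<lambda>g y. eval g [x] y) ?args (x # replicate n 0)" for x
    using eval_Proj[of 0 "[x]"] by (auto simp: list_all2_conv_all_nth less_Suc_eq_0_disj intro: eval_Zero)
  have "P x \<longleftrightarrow> (\<exists>y. eval (Comp (Mn r) ?args) [x] y)" for x
  proof
    assume "P x"
    then have ex: "\<exists>w. D w (?e x)" using D(2)[of "?e x"] by simp
    have "eval (Mn r) (x # replicate n 0) (LEAST w. D w (?e x))"
    proof (rule eval_Mn)
      show "eval r ((LEAST w. D w (?e x)) # x # replicate n 0) 0"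
        using eval_r[of "LEAST w. D w (?e x)" x] LeastI_ex[OF ex] by simp
      show "\<forall>m<LEAST w. D w (?e x). \<exists>y. eval r (m # x # replicate n 0) (Suc y)"
        using eval_r[of _ x] not_less_Least[of _ "\<lambda>w. D w (?e x)"] by (metis One_nat_def)
    qed
    then show "\<exists>y. eval (Comp (Mn r) ?args) [x] y"
      using args by (blast intro: eval_Comp)
  next
    assume "\<exists>y. eval (Comp (Mn r) ?args) [x] y"
    then obtain y ys where ys: "list_all2 (\<lambda>g y. eval g [x] y) ?args ys" and y: "eval (Mn r) ys y"
      by (auto elim: eval.cases)
    \<comment> \<open>Determinism forces the intermediate arguments, so the halting value
      \<open>y\<close> is a zero of \<open>r\<close>, that is, a witness.\<close>
    have "list_all2 (\<lambda>g y. \<forall>z. eval g [x] z \<longrightarrow> y = z) ?args ys"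
      using ys by (rule list_all2_mono) (blast intro: eval_deterministic)
    from this args have "ys = x # replicate n 0" by (rule list_all2_fun_unique)
    with y have "eval r (y # x # replicate n 0) 0" by (auto elim: eval.cases)
    from eval_deterministic[OF this eval_r] have "D y (?e x)" by (simp split: if_splits)
    then show "P x" using D(2)[of "?e x"] by auto
  qed
  then show ?thesis unfolding re_set_def by blast
qed

section \<open>Lists and inductively defined predicates\<close>

abbreviation pfst :: "nat \<Rightarrow> nat" where "pfst n \<equiv> fst (prod_decode n)"
abbreviation psnd :: "nat \<Rightarrow> nat" where "psnd n \<equiv> snd (prod_decode n)"

section \<open>Computing with coded lists\<close>

text \<open>The code of a nonempty list is the successor of a pair. The formula covers the empty
  list too, since \<open>0 - Suc 0\<close> is \<open>0\<close>, which decodes to a pair of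
  zeros.\<close>

lemma list_encode_tl: "list_encode (tl xs) = psnd (list_encode xs - Suc 0)"
proof (cases xs)
  case Nil
  have "prod_decode 0 = (0, 0)" by (simp add: prod_decode_def prod_decode_aux.simps)
  with Nil show ?thesis by simp
qed simp

lemma list_encode_hd: "xs \<noteq> [] \<Longrightarrow> hd xs = pfst (list_encode xs - Suc 0)"
  by (cases xs) simp_all

lemma list_encode_eq_0: "list_encode xs = 0 \<longleftrightarrow> xs = []"
  by (cases xs) auto

text \<open>This makes the code a bound for searches and recursions over the positions of a
  list.\<close>

lemma length_le_list_encode: "length xs \<le> list_encode xs"
proof (induction xs)
  case (Cons x xs)
  have "list_encode xs \<le> prod_encode (x, list_encode xs)" by (rule le_prod_encode_2)
  with Cons show ?case by simp
qed simp

lemma rec_fn_drop: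
  assumes "rec_fn f" "rec_fn k"
  shows "rec_fn (\<lambda>e. list_encode (drop (k e) (list_decode (f e))))"
proof -
  have "rec_nat d (\<lambda>_ r. psnd (r - Suc 0)) n = list_encode (drop n (list_decode d))" for d n
    by (induction n) (simp_all add: drop_Suc list_encode_tl flip: tl_drop)
  moreover have "rec_fn (\<lambda>e. rec_nat (f e) (\<lambda>_ r. psnd (r - Suc 0)) (k e))"
    by (intro rec_fn_rec_nat rec_fn_snd_prod_decode rec_fn_pred rec_fn_var assms)
  ultimately show ?thesis by simp
qed

text \<open>Positions range below the code, which bounds the length; those past the end are
  recognised by an empty remainder, with code \<open>0\<close>. Giving \<open>P\<close> the
  remainder allows an entry to be checked against its successors, as \<open>derivation\<close>
  requires.\<close>

lemma dec_all_tails: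
  assumes l: "rec_fn l" and P: "dec (\<lambda>e. P (e 0) (e (Suc 0)) (\<lambda>i. e (Suc (Suc i))))"
  shows "dec (\<lambda>e. \<forall>k<length (list_decode (l e)).
    P (list_decode (l e) ! k) (list_encode (drop (Suc k) (list_decode (l e)))) e)"
proof -
  let ?t = "\<lambda>e k. list_encode (drop k (list_decode (l e)))"
  have "(\<forall>k<length xs. Q (xs ! k) (list_encode (drop (Suc k) xs))) \<longleftrightarrow>
      (\<forall>k<d. list_encode (drop k xs) = 0 \<or>
        Q (pfst (list_encode (drop k xs) - Suc 0)) (list_encode (drop (Suc k) xs)))"
    if "xs = list_decode d" for xs d and Q
  proof -
    have "length xs \<le> d"
      using length_le_list_encode[of xs] that by simp
    moreover have "pfst (list_encode (drop k xs) - Suc 0) = xs ! k" if "k < length xs" for k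
      using that list_encode_hd[of "drop k xs"] by (simp add: hd_drop_conv_nth)
    ultimately show ?thesis
      by (simp add: list_encode_eq_0) (metis leD leI order_less_le_trans)
  qed
  note eq = this[OF refl, of "l e" "\<lambda>x t. P x t e" for e]
  have P': "dec (\<lambda>e. P (f e) (g e) (\<lambda>i. h i e))" if "rec_fn f" "rec_fn g" "\<And>i. rec_fn (h i)" for f g h
    using dec_subst[OF P, of "case_nat f (case_nat g h)"] that by (simp split: nat.split)
  have "dec (\<lambda>e. \<forall>k<l e. ?t e k = 0 \<or> P (pfst (?t e k - Suc 0)) (?t e (Suc k)) e)"
    by (intro dec_ball_less dec_disj dec_eq_0 P' rec_fn_fst_prod_decode rec_fn_pred rec_fn_drop
        rec_fn_Suc rec_fn_shift[OF l] rec_fn_var l)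
  then show ?thesis unfolding eq .
qed

lemma dec_list_ex:
  assumes l: "rec_fn l" and P: "dec (\<lambda>e. P (e 0) (\<lambda>i. e (Suc i)))"
  shows "dec (\<lambda>e. \<exists>x\<in>set (list_decode (l e)). P x e)"
proof -
  have "dec (\<lambda>e. \<not> (\<forall>k<length (list_decode (l e)). \<not> P (list_decode (l e) ! k) e))"
    using dec_subst_witness[OF P, of "\<lambda>e. e 0" "\<lambda>i e. e (Suc (Suc i))"]
    by (intro dec_not dec_all_tails[of l "\<lambda>x t e. \<not> P x e"] l) (simp add: rec_fn_var)
  moreover have "(\<not> (\<forall>k<length xs. \<not> P (xs ! k) e)) \<longleftrightarrow> (\<exists>x\<in>set xs. P x e)" for xs e
    by (metis in_set_conv_nth)
  ultimately show ?thesis by simp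
qed

text \<open>Since \<open>foldr\<close> starts at the end of the list, the recursion runs through the
  positions \<open>d - 1\<close> down to \<open>0\<close>, where \<open>d\<close> is the code.
  Positions past the end keep the accumulator.\<close>

lemma rec_fn_foldr:
  assumes l: "rec_fn l" and a: "rec_fn a" and g: "rec_fn (\<lambda>e. g (e 0) (e (Suc 0)) (\<lambda>i. e (Suc (Suc i))))"
  shows "rec_fn (\<lambda>e. foldr (\<lambda>x r. g x r e) (list_decode (l e)) (a e))"
proof -
  let ?t = "\<lambda>k d. list_encode (drop (d - Suc k) (list_decode d))"
  let ?step = "\<lambda>d e k r. if ?t k d = 0 then r else g (pfst (?t k d - Suc 0)) r e"
  have aux: "rec_nat b (?step d e) k = foldr (\<lambda>x r. g x r e) (drop (d - k) (list_decode d)) b"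
    if "k \<le> d" for b d e k
    using that
  proof (induction k)
    case 0
    have "length (list_decode d) \<le> d"
      using length_le_list_encode[of "list_decode d"] by simp
    then show ?case by simp
  next
    case (Suc k)
    define j where "j = d - Suc k"
    have j: "d - k = Suc j" using Suc.prems by (simp add: j_def)
    show ?case
    proof (cases "j < length (list_decode d)")
      case True
      then have "drop j (list_decode d) = list_decode d ! j # drop (d - k) (list_decode d)"
        by (simp add: Cons_nth_drop_Suc j)
      with Suc show ?thesis by (simp flip: j_def)
    next
      case False
      with Suc show ?thesis by (simp add: j flip: j_def)
    qed
  qed
  have g': "rec_fn (\<lambda>e. g (f e) (h e) (\<lambda>i. k i e))" if "rec_fn f" "rec_fn h" "\<And>i. rec_fn (k i)" for f h k
    using rec_fn_subst[OF g, of "case_nat f (case_nat h k)"] that by (simp split: nat.split)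
  have "rec_fn (\<lambda>e. rec_nat (a e) (?step (l e) e) (l e))"
    by (intro rec_fn_rec_nat rec_fn_If dec_eq_0 g' rec_fn_fst_prod_decode rec_fn_pred rec_fn_drop
        rec_fn_diff rec_fn_Suc rec_fn_shift[OF rec_fn_shift[OF l]] rec_fn_var l a)
  then show ?thesis by (simp add: aux)
qed

lemmas rec_fn_intros = rec_fn_var rec_fn_const rec_fn_Suc rec_fn_add rec_fn_prod_encode
  rec_fn_fst_prod_decode rec_fn_snd_prod_decode

lemma re_eq: "rec_fn f \<Longrightarrow> rec_fn g \<Longrightarrow> re (\<lambda>e. f e = g e)"
  by (intro re_dec dec_eq)

lemmas re_intros = re_ex re_conj re_disj re_eq rec_fn_intros

section \<open>Predicates generated by axioms and two-premise rules\<close>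

inductive closure :: "(nat \<Rightarrow> bool) \<Rightarrow> (nat \<Rightarrow> nat \<Rightarrow> nat \<Rightarrow> bool) \<Rightarrow> nat \<Rightarrow> bool" for Ax Rule where
  closure_Ax: "Ax c \<Longrightarrow> closure Ax Rule c"
| closure_Rule: "Rule c p q \<Longrightarrow> closure Ax Rule p \<Longrightarrow> closure Ax Rule q \<Longrightarrow> closure Ax Rule c"

text \<open>A line of a derivation is the code of \<open>(c, p, q, w)\<close>: conclusion, the two premises, and a
  witness for the recursively enumerable side condition; lines are justified by later list entries.\<close>

definition justified :: "(nat \<Rightarrow> nat \<Rightarrow> bool) \<Rightarrow> (nat \<Rightarrow> nat \<Rightarrow> nat \<Rightarrow> nat \<Rightarrow> bool) \<Rightarrow> nat \<Rightarrow> nat list \<Rightarrow> bool" where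
  "justified A R x rest \<longleftrightarrow>
     A (psnd (psnd (psnd x))) (pfst x) \<or>
     R (psnd (psnd (psnd x))) (pfst x) (pfst (psnd x)) (pfst (psnd (psnd x))) \<and>
       (\<exists>y\<in>set rest. pfst y = pfst (psnd x)) \<and> (\<exists>y\<in>set rest. pfst y = pfst (psnd (psnd x)))"

fun derivation :: "(nat \<Rightarrow> nat \<Rightarrow> bool) \<Rightarrow> (nat \<Rightarrow> nat \<Rightarrow> nat \<Rightarrow> nat \<Rightarrow> bool) \<Rightarrow> nat list \<Rightarrow> bool" where
  "derivation A R [] \<longleftrightarrow> True"
| "derivation A R (x # xs) \<longleftrightarrow> justified A R x xs \<and> derivation A R xs"

text \<open>A justification survives when lines are added after it, since the stock of available
  premises only grows.\<close>

lemma derivation_append: "derivation A R xs \<Longrightarrow> derivation A R ys \<Longrightarrow> derivation A R (xs @ ys)"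
  by (induction xs) (auto simp: justified_def)

lemma derivation_iff_nth:
  "derivation A R xs \<longleftrightarrow> (\<forall>k<length xs. justified A R (xs ! k) (drop (Suc k) xs))"
proof (induction xs)
  case (Cons x xs)
  then show ?case by (simp add: All_less_Suc2)
qed simp

text \<open>The derivations of both premises are concatenated after the new line. Conversely,
  induction on the list puts the conclusion of every line into the closure.\<close>

lemma closure_iff_derivation:
  "closure (\<lambda>c. \<exists>w. A w c) (\<lambda>c p q. \<exists>w. R w c p q) c \<longleftrightarrow>
     (\<exists>xs. derivation A R xs \<and> (\<exists>x\<in>set xs. pfst x = c))"
  (is "?C c \<longleftrightarrow> ?D c")
proof
  show "?C c \<Longrightarrow> ?D c"
  proof (induction rule: closure.induct)
    case (closure_Ax c)
    then obtain w where "A w c" by blast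
    then show ?case
      \<comment> \<open>An axiom line carries the default \<open>0\<close> in both premise
        fields.\<close>
      by (intro exI[of _ "[prod_encode (c, prod_encode (0, prod_encode (0, w)))]"])
        (simp add: justified_def)
  next
    case (closure_Rule c p q)
    then obtain w xs ys where "R w c p q" "derivation A R xs" "\<exists>x\<in>set xs. pfst x = p"
      "derivation A R ys" "\<exists>x\<in>set ys. pfst x = q" by blast
    then show ?case
      by (intro exI[of _ "prod_encode (c, prod_encode (p, prod_encode (q, w))) # xs @ ys"])
        (auto simp: justified_def derivation_append)
  qed
next
  have "derivation A R xs \<Longrightarrow> \<forall>x\<in>set xs. ?C (pfst x)" for xs
  proof (induction xs)
    case (Cons x xs)
    then have IH: "\<forall>y\<in>set xs. ?C (pfst y)" and "justified A R x xs" by auto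
    from this(2) have "?C (pfst x)" unfolding justified_def
    proof (elim disjE conjE bexE)
      assume "A (psnd (psnd (psnd x))) (pfst x)"
      then show ?thesis by (blast intro: closure.intros)
    next
      fix y z
      assume "R (psnd (psnd (psnd x))) (pfst x) (pfst (psnd x)) (pfst (psnd (psnd x)))"
        "y \<in> set xs" "z \<in> set xs" "pfst y = pfst (psnd x)" "pfst z = pfst (psnd (psnd x))"
      with IH show ?thesis
        by - (rule closure.closure_Rule[where c = "pfst x" and p = "pfst y" and q = "pfst z"], auto)
    qed
    with IH show ?case by simp
  qed simp
  then show "?D c \<Longrightarrow> ?C c" by blast
qed

text \<open>Membership means that some number codes a derivation containing the conclusion. As the
  lines carry the witnesses of the side conditions, checking a derivation is decidable.\<close>

lemma re_closure:
  assumes Ax: "re (\<lambda>e. Ax (e 0))" and Rule: "re (\<lambda>e. Rule (e 0) (e (Suc 0)) (e (Suc (Suc 0))))"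
  shows "re (\<lambda>e. closure Ax Rule (e 0))"
proof -
  from Ax obtain DA where DA: "dec (\<lambda>e. DA (e 0) (\<lambda>i. e (Suc i)))"
    "\<And>e. Ax (e 0) \<longleftrightarrow> (\<exists>w. DA w e)" by (rule reE) (rule that)
  from Rule obtain DR where DR: "dec (\<lambda>e. DR (e 0) (\<lambda>i. e (Suc i)))"
    "\<And>e. Rule (e 0) (e (Suc 0)) (e (Suc (Suc 0))) \<longleftrightarrow> (\<exists>w. DR w e)" by (rule reE) (rule that)
  \<comment> \<open>\<open>DA\<close> and \<open>DR\<close> take whole environments; repeating the
    last argument in all further variables turns them into predicates of finitely many
    numbers.\<close>
  define A where "A w c = DA w (\<lambda>_. c)" for w c
  define R where "R w c p q = DR w (case_nat c (case_nat p (\<lambda>_. q)))" for w c p q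
  have Ax_eq: "Ax = (\<lambda>c. \<exists>w. A w c)"
    using DA(2)[of "\<lambda>_. c" for c] by (simp add: A_def fun_eq_iff)
  have Rule_eq: "Rule = (\<lambda>c p q. \<exists>w. R w c p q)"
    using DR(2)[of "case_nat c (case_nat p (\<lambda>_. q))" for c p q] by (simp add: R_def fun_eq_iff)
  have A: "dec (\<lambda>e. A (f e) (g e))" if "rec_fn f" "rec_fn g" for f g
    unfolding A_def using dec_subst_witness[OF DA(1), of f "\<lambda>_. g"] that by simp
  have R: "dec (\<lambda>e. R (f e) (g e) (h e) (k e))" if "rec_fn f" "rec_fn g" "rec_fn h" "rec_fn k" for f g h k
  proof -
    have "(\<lambda>i. case_nat g (case_nat h (\<lambda>_. k)) i e) = case_nat (g e) (case_nat (h e) (\<lambda>_. k e))" for e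
      by (auto split: nat.split)
    then show ?thesis
      unfolding R_def using dec_subst_witness[OF DR(1), of f "case_nat g (case_nat h (\<lambda>_. k))"] that
      by (simp split: nat.split)
  qed
  have "dec (\<lambda>e. justified A R (e 0) (list_decode (e (Suc 0))))"
    unfolding justified_def
    by (intro dec_disj dec_conj A R dec_list_ex dec_eq rec_fn_intros)
  then have "dec (\<lambda>e. derivation A R (list_decode (e 0)))"
    unfolding derivation_iff_nth
    using dec_all_tails[of "\<lambda>e. e 0" "\<lambda>x t e. justified A R x (list_decode t)"]
    by (simp add: rec_fn_var)
  then have deriv: "dec (\<lambda>e. derivation A R (list_decode (f e)))" if "rec_fn f" for f
    using dec_subst[of "\<lambda>e. derivation A R (list_decode (e 0))" "\<lambda>_. f"] that by simp
  have "re (\<lambda>e. \<exists>d. derivation A R (list_decode d) \<and> (\<exists>x\<in>set (list_decode d). pfst x = e 0))"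
    by (intro re_ex re_dec dec_conj deriv dec_list_ex dec_eq rec_fn_intros)
  moreover have "(\<exists>d. derivation A R (list_decode d) \<and> (\<exists>x\<in>set (list_decode d). pfst x = c)) \<longleftrightarrow>
      (\<exists>xs. derivation A R xs \<and> (\<exists>x\<in>set xs. pfst x = c))" for c
    by (metis list_encode_inverse)
  ultimately show ?thesis
    unfolding Ax_eq Rule_eq closure_iff_derivation by simp
qed

section \<open>A universal function\<close>

fun recf_code :: "recf \<Rightarrow> nat" where
  "recf_code Zero = prod_encode (0, 0)"
| "recf_code Succ = prod_encode (1, 0)"
| "recf_code (Proj i) = prod_encode (2, i)"
| "recf_code (Comp f gs) = prod_encode (3, prod_encode (recf_code f, list_encode (map recf_code gs)))"
| "recf_code (Prec f g) = prod_encode (4, prod_encode (recf_code f, recf_code g))"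
| "recf_code (Mn f) = prod_encode (5, recf_code f)"

abbreviation consc :: "nat \<Rightarrow> nat \<Rightarrow> nat" where
  "consc x n \<equiv> Suc (prod_encode (x, n))"

abbreviation quad :: "nat \<Rightarrow> nat \<Rightarrow> nat \<Rightarrow> nat \<Rightarrow> nat" where
  "quad a b c d \<equiv> prod_encode (a, prod_encode (b, prod_encode (c, d)))"

text \<open>Judgements \<open>quad k f xs y\<close>, everything coded by numbers: for \<open>k = 0\<close> the function \<open>f\<close> maps
  \<open>xs\<close> to \<open>y\<close>, for \<open>k = 1\<close> the functions in the list \<open>f\<close> map \<open>xs\<close> to the entries of the list \<open>y\<close>,
  and for \<open>k = 2\<close> the function \<open>f\<close> is positive on \<open>m # xs\<close> for all \<open>m < y\<close>. The two auxiliary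
  judgements make two premises per rule suffice.\<close>

definition eval_ax :: "nat \<Rightarrow> bool" where
  "eval_ax c \<longleftrightarrow>
     (\<exists>v. c = quad 0 (prod_encode (0, 0)) v 0) \<or>
     (\<exists>x v. c = quad 0 (prod_encode (1, 0)) (consc x v) (Suc x)) \<or>
     (\<exists>x v. c = quad 0 (prod_encode (2, 0)) (consc x v) x) \<or>
     (\<exists>v. c = quad 1 0 v 0) \<or>
     (\<exists>f v. c = quad 2 f v 0)"

text \<open>A rule with only one genuine premise states it twice, by \<open>q = p\<close>.\<close>

definition eval_rule :: "nat \<Rightarrow> nat \<Rightarrow> nat \<Rightarrow> bool" where
  "eval_rule c p q \<longleftrightarrow>
     (\<exists>i x v y. c = quad 0 (prod_encode (2, Suc i)) (consc x v) y \<and>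
        p = quad 0 (prod_encode (2, i)) v y \<and> q = p) \<or>
     (\<exists>f gs v u y. c = quad 0 (prod_encode (3, prod_encode (f, gs))) v y \<and>
        p = quad 1 gs v u \<and> q = quad 0 f u y) \<or>
     (\<exists>f g v y. c = quad 0 (prod_encode (4, prod_encode (f, g))) (consc 0 v) y \<and>
        p = quad 0 f v y \<and> q = p) \<or>
     (\<exists>f g n r v y. c = quad 0 (prod_encode (4, prod_encode (f, g))) (consc (Suc n) v) y \<and>
        p = quad 0 (prod_encode (4, prod_encode (f, g))) (consc n v) r \<and>
        q = quad 0 g (consc n (consc r v)) y) \<or>
     (\<exists>f v n. c = quad 0 (prod_encode (5, f)) v n \<and>
        p = quad 0 f (consc n v) 0 \<and> q = quad 2 f v n) \<or>
     (\<exists>g gs v y u. c = quad 1 (consc g gs) v (consc y u) \<and>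
        p = quad 0 g v y \<and> q = quad 1 gs v u) \<or>
     (\<exists>f v n y. c = quad 2 f v (Suc n) \<and>
        p = quad 2 f v n \<and> q = quad 0 f (consc n v) (Suc y))"

abbreviation eval_closure :: "nat \<Rightarrow> bool" where
  "eval_closure \<equiv> closure eval_ax eval_rule"

lemma re_eval_closure: "re (\<lambda>e. eval_closure (e 0))"
  by (rule re_closure; unfold eval_ax_def eval_rule_def; intro re_intros)

lemma eval_closure_complete:
  "eval f xs y \<Longrightarrow> eval_closure (quad 0 (recf_code f) (list_encode xs) y)"
proof (induction rule: eval.induct)
  case (eval_Zero xs)
  show ?case by (rule closure_Ax) (simp add: eval_ax_def prod_encode_eq)
next
  case (eval_Succ x xs)
  show ?case by (rule closure_Ax) (simp add: eval_ax_def prod_encode_eq)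
next
  case (eval_Proj i xs)
  \<comment> \<open>The axiom covers index \<open>0\<close>; for larger indices the rule removes the
    head of the argument list.\<close>
  then show ?case
  proof (induction i arbitrary: xs)
    case 0
    then show ?case by (intro closure_Ax) (cases xs; simp add: eval_ax_def prod_encode_eq)
  next
    case (Suc i)
    then obtain x xs' where xs: "xs = x # xs'" by (cases xs) auto
    show ?case
      by (rule closure_Rule[OF _ Suc.IH[of xs'] Suc.IH[of xs']])
        (use Suc.prems in \<open>auto simp: xs eval_rule_def prod_encode_eq\<close>)
  qed
next
  case (eval_Comp xs gs ys f y)
  from eval_Comp.IH(1)
  have ys: "eval_closure (quad 1 (list_encode (map recf_code gs)) (list_encode xs) (list_encode ys))"
  proof (induction rule: list_all2_induct)
    case Nil
    show ?case by (rule closure_Ax) (simp add: eval_ax_def prod_encode_eq)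
  next
    case (Cons g gs y ys)
    show ?case
      by (rule closure_Rule[OF _ conjunct2[OF Cons.hyps(1)] Cons.IH]) (simp add: eval_rule_def prod_encode_eq)
  qed
  show ?case
    by (rule closure_Rule[OF _ ys eval_Comp.IH(2)]) (simp add: eval_rule_def prod_encode_eq)
next
  case (eval_Prec0 f xs y g)
  show ?case
    by (rule closure_Rule[OF _ eval_Prec0.IH eval_Prec0.IH]) (simp add: eval_rule_def prod_encode_eq)
next
  case (eval_PrecS f g n xs r y)
  show ?case
    by (rule closure_Rule[OF _ eval_PrecS.IH]) (simp add: eval_rule_def prod_encode_eq)
next
  case (eval_Mn f n xs)
  from eval_Mn.IH(2)
  have n: "eval_closure (quad 2 (recf_code f) (list_encode xs) n)"
  proof (induction n)
    case 0
    show ?case by (rule closure_Ax) (simp add: eval_ax_def prod_encode_eq)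
  next
    case (Suc n)
    then obtain y where y: "eval_closure (quad 0 (recf_code f) (list_encode (n # xs)) (Suc y))"
      by blast
    have n: "eval_closure (quad 2 (recf_code f) (list_encode xs) n)"
      using Suc by simp
    show ?case
      by (rule closure_Rule[OF _ n y]) (simp add: eval_rule_def prod_encode_eq)
  qed
  show ?case
    by (rule closure_Rule[OF _ eval_Mn.IH(1) n]) (simp add: eval_rule_def prod_encode_eq)
qed

lemma list_encode_eq_consc: "list_encode xs = consc x n \<longleftrightarrow> (\<exists>ys. xs = x # ys \<and> list_encode ys = n)"
  by (cases xs) (auto simp: prod_encode_eq)

lemma eval_Proj_Suc: "eval (Proj i) xs y \<Longrightarrow> eval (Proj (Suc i)) (x # xs) y"
  using eval_Proj[of "Suc i" "x # xs"] by (auto elim!: eval.cases)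

text \<open>The three kinds of judgement feed into each other and need a simultaneous induction.
  Derivable judgements may also mention numbers that code no program, so the claims speak only of
  those of the form \<open>recf_code f\<close>.\<close>

lemma eval_closure_sound:
  "eval_closure c \<Longrightarrow>
     (\<forall>f xs y. c = quad 0 (recf_code f) (list_encode xs) y \<longrightarrow> eval f xs y) \<and>
     (\<forall>gs xs ys. c = quad 1 (list_encode (map recf_code gs)) (list_encode xs) (list_encode ys) \<longrightarrow>
        list_all2 (\<lambda>g y. eval g xs y) gs ys) \<and>
     (\<forall>f xs n. c = quad 2 (recf_code f) (list_encode xs) n \<longrightarrow>
        (\<forall>m<n. \<exists>y. eval f (m # xs) (Suc y)))"
proof (induction rule: closure.induct)
  case (closure_Ax c)
  have "eval f xs y" if c: "c = quad 0 (recf_code f) (list_encode xs) y" for f xs y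
    using closure_Ax eval_Proj[of 0 xs]
    by (cases f) (auto simp: c eval_ax_def prod_encode_eq list_encode_eq_consc intro: eval.intros)
  moreover have "list_all2 (\<lambda>g y. eval g xs y) gs ys"
    if c: "c = quad 1 (list_encode (map recf_code gs)) (list_encode xs) (list_encode ys)" for gs xs ys
    using closure_Ax by (auto simp: c eval_ax_def prod_encode_eq list_encode_eq_0)
  moreover have "n = 0" if c: "c = quad 2 (recf_code f) (list_encode xs) n" for f xs n
    using closure_Ax by (auto simp: c eval_ax_def prod_encode_eq)
  ultimately show ?case by blast
next
  case (closure_Rule c p q)
  note p0 = closure_Rule.IH(1)[THEN conjunct1, rule_format]
    and p1 = closure_Rule.IH(1)[THEN conjunct2, THEN conjunct1, rule_format]
    and p2 = closure_Rule.IH(1)[THEN conjunct2, THEN conjunct2, rule_format]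
    and q0 = closure_Rule.IH(2)[THEN conjunct1, rule_format]
    and q1 = closure_Rule.IH(2)[THEN conjunct2, THEN conjunct1, rule_format]
    and q2 = closure_Rule.IH(2)[THEN conjunct2, THEN conjunct2, rule_format]
  have "eval f xs y" if c: "c = quad 0 (recf_code f) (list_encode xs) y" for f xs y
  proof (cases f)
    case Zero
    then show ?thesis using closure_Rule.hyps(1) by (simp add: c eval_rule_def prod_encode_eq)
  next
    case Succ
    then show ?thesis using closure_Rule.hyps(1) by (simp add: c eval_rule_def prod_encode_eq)
  next
    case (Proj i)
    then obtain j x ys where j: "i = Suc j" "xs = x # ys"
        "p = quad 0 (recf_code (Proj j)) (list_encode ys) y"
      using closure_Rule.hyps(1) by (auto simp: c eval_rule_def prod_encode_eq list_encode_eq_consc)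
    show ?thesis using eval_Proj_Suc[OF p0[OF j(3)]] by (simp add: Proj j(1,2))
  next
    case (Comp g gs)
    then obtain u where u: "p = quad 1 (list_encode (map recf_code gs)) (list_encode xs) u"
        "q = quad 0 (recf_code g) u y"
      using closure_Rule.hyps(1) by (auto simp: c eval_rule_def prod_encode_eq)
    \<comment> \<open>Every number codes a list, so the intermediate \<open>u\<close> is a list of
      argument values.\<close>
    define ys where "ys = list_decode u"
    then have ys: "u = list_encode ys" by simp
    show ?thesis using eval_Comp[OF p1[OF u(1)[unfolded ys]] q0[OF u(2)[unfolded ys]]] by (simp add: Comp)
  next
    case (Prec g h)
    from closure_Rule.hyps(1) Prec consider
        ys where "xs = 0 # ys" "p = quad 0 (recf_code g) (list_encode ys) y"
      | n ys r where "xs = Suc n # ys" "p = quad 0 (recf_code (Prec g h)) (list_encode (n # ys)) r"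
        "q = quad 0 (recf_code h) (list_encode (n # r # ys)) y"
      by (auto simp: c eval_rule_def prod_encode_eq list_encode_eq_consc)
    then show ?thesis
    proof cases
      case 1
      show ?thesis using eval_Prec0[OF p0[OF 1(2)]] by (simp add: 1(1) Prec)
    next
      case 2
      show ?thesis using eval_PrecS[OF p0[OF 2(2)] q0[OF 2(3)]] by (simp add: 2(1) Prec)
    qed
  next
    case (Mn g)
    then have y: "p = quad 0 (recf_code g) (list_encode (y # xs)) 0"
        "q = quad 2 (recf_code g) (list_encode xs) y"
      using closure_Rule.hyps(1) by (auto simp: c eval_rule_def prod_encode_eq)
    show ?thesis using eval_Mn[OF p0[OF y(1)]] q2[OF y(2)] by (simp add: Mn)
  qed
  moreover have "list_all2 (\<lambda>g y. eval g xs y) gs ys"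
    if c: "c = quad 1 (list_encode (map recf_code gs)) (list_encode xs) (list_encode ys)" for gs xs ys
  proof -
    obtain g gs' y ys' where g: "gs = g # gs'" "ys = y # ys'"
      "p = quad 0 (recf_code g) (list_encode xs) y"
      "q = quad 1 (list_encode (map recf_code gs')) (list_encode xs) (list_encode ys')"
      using closure_Rule.hyps(1)
      by (auto simp: c eval_rule_def prod_encode_eq list_encode_eq_consc map_eq_Cons_conv)
    show ?thesis using p0[OF g(3)] q1[OF g(4)] by (simp add: g(1,2))
  qed
  moreover have "\<exists>y. eval f (m # xs) (Suc y)"
    if c: "c = quad 2 (recf_code f) (list_encode xs) n" and m: "m < n" for f xs n m
  proof -
    obtain k y where k: "n = Suc k" "p = quad 2 (recf_code f) (list_encode xs) k"
      "q = quad 0 (recf_code f) (list_encode (k # xs)) (Suc y)"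
      using closure_Rule.hyps(1) by (auto simp: c eval_rule_def prod_encode_eq)
    show ?thesis using m k(1) p2[OF k(2)] q0[OF k(3)] by (auto simp: less_Suc_eq)
  qed
  ultimately show ?case by blast
qed

text \<open>\<open>W i\<close> is the domain of the unary function with code \<open>i\<close>.\<close>

definition W :: "nat \<Rightarrow> nat \<Rightarrow> bool" where
  "W i n \<longleftrightarrow> (\<exists>y. eval_closure (quad 0 i (consc n 0) y))"

lemma W_recf_code: "W (recf_code f) n \<longleftrightarrow> (\<exists>y. eval f [n] y)"
proof -
  have "eval_closure (quad 0 (recf_code f) (consc n 0) y) \<longleftrightarrow> eval f [n] y" for y
    using eval_closure_complete[of f "[n]" y] eval_closure_sound[of "quad 0 (recf_code f) (list_encode [n]) y"]
    by auto
  then show ?thesis by (simp add: W_def)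
qed

text \<open>Enumerability holds jointly in the index and the element, which lets one presentation
  incorporate the relators of all copies.\<close>

lemma re_W:
  assumes "rec_fn f" "rec_fn g"
  shows "re (\<lambda>e. W (f e) (g e))"
proof (rule re_subst2[OF _ assms])
  show "re (\<lambda>e. W (e 0) (e (Suc 0)))"
    unfolding W_def by (intro re_ex re_subst1[OF re_eval_closure] rec_fn_intros)
qed

lemma re_set_index:
  assumes "re_set S"
  obtains i where "\<And>n. n \<in> S \<longleftrightarrow> W i n"
proof -
  obtain f where "S = {n. \<exists>y. eval f [n] y}"
    using assms unfolding re_set_def by blast
  then show thesis by (intro that[of "recf_code f"]) (simp add: W_recf_code)
qed

section \<open>The universal congruence on words\<close>

definition append_code :: "nat \<Rightarrow> nat \<Rightarrow> nat" where
  "append_code m n = list_encode (list_decode m @ list_decode n)"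

definition power_code :: "nat \<Rightarrow> nat \<Rightarrow> nat" where
  "power_code k n = list_encode (concat (replicate k (list_decode n)))"

definition shift_code :: "nat \<Rightarrow> nat \<Rightarrow> nat" where
  "shift_code i n =
     list_encode (map (\<lambda>l. prod_encode (prod_encode (i, pfst l), psnd l)) (list_decode n))"

lemma rec_fn_append_code:
  assumes "rec_fn f" "rec_fn g"
  shows "rec_fn (\<lambda>e. append_code (f e) (g e))"
proof -
  have "foldr consc xs n = list_encode (xs @ list_decode n)" for xs n
    by (induction xs) simp_all
  moreover have "rec_fn (\<lambda>e. foldr (\<lambda>x r. consc x r) (list_decode (f e)) (g e))"
    by (intro rec_fn_foldr rec_fn_intros assms)
  ultimately show ?thesis by (simp add: append_code_def)
qed

lemma rec_fn_power_code:
  assumes "rec_fn f" "rec_fn g"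
  shows "rec_fn (\<lambda>e. power_code (f e) (g e))"
proof -
  have "rec_nat 0 (\<lambda>_ r. append_code n r) k = power_code k n" for k n
    by (induction k) (simp_all add: power_code_def append_code_def)
  moreover have "rec_fn (\<lambda>e. rec_nat 0 (\<lambda>k r. append_code (g e) r) (f e))"
    by (intro rec_fn_rec_nat rec_fn_append_code rec_fn_shift[OF rec_fn_shift[OF assms(2)]]
        rec_fn_intros assms)
  ultimately show ?thesis by simp
qed

lemma rec_fn_shift_code:
  assumes "rec_fn f" "rec_fn g"
  shows "rec_fn (\<lambda>e. shift_code (f e) (g e))"
proof -
  have "foldr (\<lambda>l r. consc (prod_encode (prod_encode (i, pfst l), psnd l)) r) xs 0
      = list_encode (map (\<lambda>l. prod_encode (prod_encode (i, pfst l), psnd l)) xs)" for xs i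
    by (induction xs) simp_all
  moreover have "rec_fn (\<lambda>e. foldr (\<lambda>l r. consc (prod_encode (prod_encode (f e, pfst l), psnd l)) r) (list_decode (g e)) 0)"
    by (intro rec_fn_foldr rec_fn_shift[OF rec_fn_shift[OF assms(1)]] rec_fn_intros assms)
  ultimately show ?thesis by (simp add: shift_code_def)
qed

abbreviation letter_code :: "nat \<times> bool \<Rightarrow> nat" where
  "letter_code \<equiv> \<lambda>(x, b). prod_encode (x, if b then 1 else 0)"

text \<open>Pairing with \<open>i\<close> makes the generators of different copies disjoint.\<close>

definition shift :: "nat \<Rightarrow> word \<Rightarrow> word" where
  "shift i = map (\<lambda>(x, b). (prod_encode (i, x), b))"

definition wpow :: "word \<Rightarrow> nat \<Rightarrow> word" where
  "wpow w n = concat (replicate n w)"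

lemma inj_letter_code: "inj letter_code"
  by (auto simp: inj_on_def prod_encode_eq split: if_splits)

lemma word_code_eq_iff: "word_code u = word_code v \<longleftrightarrow> u = v"
  unfolding word_code_def list_encode_eq by (rule inj_map_eq_map[OF inj_letter_code])

lemma word_code_Nil: "word_code [] = 0"
  by (simp add: word_code_def)

lemma word_code_Cons: "word_code ((x, b) # w) = consc (prod_encode (x, if b then 1 else 0)) (word_code w)"
  by (simp add: word_code_def)

lemma append_code_word_code: "append_code (word_code u) (word_code v) = word_code (u @ v)"
  by (simp add: append_code_def word_code_def)

lemma power_code_word_code: "power_code n (word_code w) = word_code (wpow w n)"
  by (simp add: power_code_def word_code_def wpow_def map_concat)

lemma shift_code_word_code: "shift_code i (word_code w) = word_code (shift i w)"
  by (simp add: shift_code_def word_code_def shift_def case_prod_unfold comp_def)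

text \<open>A number codes a word only if every letter has sign \<open>0\<close> or
  \<open>1\<close>, a condition that factors inherit. Hence one premise about the concatenation
  certifies both factors in the torsion rule.\<close>

lemma append_code_eq_word_code:
  assumes "append_code m n = word_code w"
  obtains u v where "m = word_code u" "n = word_code v" "w = u @ v"
proof -
  have "list_decode m @ list_decode n = map letter_code w"
    using assms by (simp add: append_code_def word_code_def list_encode_eq)
  then obtain u v where uv: "w = u @ v" "list_decode m = map letter_code u" "list_decode n = map letter_code v"
    unfolding append_eq_map_conv by blast
  have "m = word_code u" "n = word_code v"
    unfolding word_code_def uv(2,3)[symmetric] by simp_all
  with uv(1) show thesis by (intro that)
qed

text \<open>\<open>T\<close> is the set of torsion exponents and \<open>R i\<close> the set of codes of the relators of the \<open>i\<close>-th
  copy. Cancellation, relators and torsion act only at the front of a word, which together with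
  \<open>teq_Cons\<close> already gives a two-sided congruence.\<close>

inductive teq :: "(nat \<Rightarrow> bool) \<Rightarrow> (nat \<Rightarrow> nat \<Rightarrow> bool) \<Rightarrow> word \<Rightarrow> word \<Rightarrow> bool" for T R where
  teq_Nil: "teq T R [] []"
| teq_sym: "teq T R u v \<Longrightarrow> teq T R v u"
| teq_trans: "teq T R u v \<Longrightarrow> teq T R v w \<Longrightarrow> teq T R u w"
| teq_Cons: "teq T R u v \<Longrightarrow> teq T R (l # u) (l # v)"
| teq_cancel: "teq T R ((x, b) # (x, \<not> b) # w) w"
| teq_rel: "R i (word_code r) \<Longrightarrow> teq T R (shift i r @ w) w"
| teq_tors: "T n \<Longrightarrow> teq T R (wpow u n) [] \<Longrightarrow> teq T R (u @ w) w"

lemma teq_refl: "teq T R w w"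
  by (induction w) (auto intro: teq_Nil teq_Cons)

lemma teq_append_left: "teq T R u v \<Longrightarrow> teq T R (w @ u) (w @ v)"
  by (induction w) (auto intro: teq_Cons)

text \<open>Cancellation, relators and torsion leave an arbitrary remainder behind, and appending
  merely lengthens this remainder.\<close>

lemma teq_append_right: "teq T R u v \<Longrightarrow> teq T R (u @ w) (v @ w)"
proof (induction rule: teq.induct)
  case (teq_trans u v w')
  then show ?case by (blast intro: teq.teq_trans)
next
  case (teq_tors n u w')
  then show ?case using teq.teq_tors[of T n R u "w' @ w"] by simp
next
  case (teq_rel i r w')
  then show ?case using teq.teq_rel[of R i r T "w' @ w"] by simp
qed (simp_all add: teq_refl teq_Cons teq_cancel teq_sym)

section \<open>Enumerability of the universal congruence\<close>

definition teq_ax :: "nat \<Rightarrow> bool" where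
  "teq_ax c \<longleftrightarrow> c = prod_encode (0, 0)"

text \<open>Premises of the form \<open>(u, u)\<close> only assert that \<open>u\<close> is the code of a word.\<close>

definition teq_rule :: "(nat \<Rightarrow> bool) \<Rightarrow> (nat \<Rightarrow> nat \<Rightarrow> bool) \<Rightarrow> nat \<Rightarrow> nat \<Rightarrow> nat \<Rightarrow> bool" where
  "teq_rule T R c p q \<longleftrightarrow>
     (\<exists>u v. c = prod_encode (v, u) \<and> p = prod_encode (u, v) \<and> q = p) \<or>
     (\<exists>u v w. c = prod_encode (u, w) \<and> p = prod_encode (u, v) \<and> q = prod_encode (v, w)) \<or>
     (\<exists>x b b' u v. b + b' = 1 \<and> c = prod_encode (consc (prod_encode (x, b)) u, consc (prod_encode (x, b)) v) \<and>
        p = prod_encode (u, v) \<and> q = p) \<or>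
     (\<exists>x b b' u. b + b' = 1 \<and>
        c = prod_encode (consc (prod_encode (x, b)) (consc (prod_encode (x, b')) u), u) \<and>
        p = prod_encode (u, u) \<and> q = p) \<or>
     (\<exists>i r u. R i r \<and> c = prod_encode (append_code (shift_code i r) u, u) \<and>
        p = prod_encode (u, u) \<and> q = prod_encode (r, r)) \<or>
     (\<exists>n u v. T n \<and> c = prod_encode (append_code u v, v) \<and>
        p = prod_encode (power_code n u, 0) \<and> q = prod_encode (append_code u v, append_code u v))"

lemma closure_teq_sound:
  "closure teq_ax (teq_rule T R) c \<Longrightarrow> \<exists>u v. c = prod_encode (word_code u, word_code v) \<and> teq T R u v"
proof (induction rule: closure.induct)
  case (closure_Ax c)
  then show ?case
    by (intro exI[of _ "[]"]) (simp add: teq_ax_def word_code_Nil teq_Nil)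
next
  case (closure_Rule c p q)
  then obtain u v u' v' where p: "p = prod_encode (word_code u, word_code v)" "teq T R u v"
    and q: "q = prod_encode (word_code u', word_code v')" "teq T R u' v'" by blast
  from closure_Rule.hyps(1) show ?case unfolding teq_rule_def
  proof (elim disjE exE conjE)
    fix m n assume "c = prod_encode (n, m)" "p = prod_encode (m, n)"
    with p show ?thesis by (auto simp: prod_encode_eq intro: teq_sym)
  next
    fix m n k assume "c = prod_encode (m, k)" "p = prod_encode (m, n)" "q = prod_encode (n, k)"
    with p q show ?thesis by (auto simp: prod_encode_eq word_code_eq_iff intro: teq_trans)
  next
    fix x b b' m n
    assume c: "c = prod_encode (consc (prod_encode (x, b)) m, consc (prod_encode (x, b)) n)"
      and "p = prod_encode (m, n)" and b: "b + b' = 1"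
    \<comment> \<open>Over the natural numbers \<open>b + b' = 1\<close> leaves only the signs
      \<open>0\<close> and \<open>1\<close>, so \<open>b\<close> is the sign of the truth value
      \<open>b = 1\<close>.\<close>
    moreover have "b = (if b = 1 then 1 else 0)" using b by auto
    ultimately have "c = prod_encode (word_code ((x, b = 1) # u), word_code ((x, b = 1) # v))"
      using p(1) by (simp add: prod_encode_eq word_code_Cons)
    then show ?thesis using teq_Cons[OF p(2)] by blast
  next
    fix x b b' m
    assume c: "c = prod_encode (consc (prod_encode (x, b)) (consc (prod_encode (x, b')) m), m)"
      and "p = prod_encode (m, m)" and b: "b + b' = 1"
    moreover have "b = (if b = 1 then 1 else 0)" "b' = (if \<not> b = 1 then 1 else 0)" using b by auto
    ultimately have "c = prod_encode (word_code ((x, b = 1) # (x, \<not> b = 1) # u), word_code u)"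
      using p(1) by (simp add: prod_encode_eq word_code_Cons)
    then show ?thesis using teq_cancel by blast
  next
    fix i r m
    assume "R i r" "c = prod_encode (append_code (shift_code i r) m, m)"
      "p = prod_encode (m, m)" "q = prod_encode (r, r)"
    with p(1) q(1) have "R i (word_code u')" "c = prod_encode (word_code (shift i u' @ u), word_code u)"
      by (auto simp: prod_encode_eq shift_code_word_code append_code_word_code)
    then show ?thesis using teq_rel by blast
  next
    fix n m k
    assume T: "T n" and c: "c = prod_encode (append_code m k, k)"
      and p': "p = prod_encode (power_code n m, 0)" and q': "q = prod_encode (append_code m k, append_code m k)"
    from q(1) q' have "append_code m k = word_code u'" by (simp add: prod_encode_eq)
    then obtain y z where yz: "m = word_code y" "k = word_code z" by (rule append_code_eq_word_code)
    from p(1) p' have "u = wpow y n" "v = []"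
      by (simp_all add: yz prod_encode_eq power_code_word_code word_code_eq_iff flip: word_code_Nil)
    with teq_tors[of T n R y z] T p(2) c show ?thesis
      by (auto simp: yz append_code_word_code)
  qed
qed

lemma closure_teq_complete:
  "teq T R u v \<Longrightarrow> closure teq_ax (teq_rule T R) (prod_encode (word_code u, word_code v))"
proof (induction rule: teq.induct)
  let ?C = "closure teq_ax (teq_rule T R)"
  have Cons: "?C (prod_encode (word_code (l # u), word_code (l # v)))"
    if "?C (prod_encode (word_code u, word_code v))" for l u v
  proof (cases l)
    case (Pair x b)
    show ?thesis
      by (rule closure_Rule[OF _ that that])
        (auto simp: Pair teq_rule_def prod_encode_eq word_code_Cons)
  qed
  have Nil: "?C (prod_encode (word_code [], word_code []))"
    by (rule closure_Ax) (simp add: teq_ax_def word_code_Nil)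
  \<comment> \<open>These judgements supply the premises asserting that a number codes a
    word.\<close>
  have refl: "?C (prod_encode (word_code w, word_code w))" for w
    by (induction w) (simp_all add: Nil Cons)
  {
    case teq_Nil
    show ?case by (rule Nil)
  next
    case (teq_sym u v)
    show ?case
      by (rule closure_Rule[OF _ teq_sym.IH teq_sym.IH]) (simp add: teq_rule_def prod_encode_eq)
  next
    case (teq_trans u v w)
    show ?case
      by (rule closure_Rule[OF _ teq_trans.IH]) (simp add: teq_rule_def prod_encode_eq)
  next
    case (teq_Cons u v l)
    show ?case by (rule Cons[OF teq_Cons.IH])
  next
    case (teq_cancel x b w)
    show ?case
      by (rule closure_Rule[OF _ refl[of w] refl[of w]])
        (simp add: teq_rule_def prod_encode_eq word_code_Cons)
  next
    case (teq_rel i r w)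
    then show ?case
      by (intro closure_Rule[OF _ refl[of w] refl[of r]])
        (auto simp: teq_rule_def prod_encode_eq simp flip: append_code_word_code shift_code_word_code)
  next
    case (teq_tors n u w)
    show ?case
      by (rule closure_Rule[OF _ teq_tors.IH refl[of "u @ w"]])
        (use teq_tors.hyps in \<open>auto simp: teq_rule_def prod_encode_eq word_code_Nil
          simp flip: append_code_word_code power_code_word_code\<close>)
  }
qed

text \<open>The trivial words are the section of the enumerable congruence at the empty word, whose
  code is \<open>0\<close>.\<close>

lemma re_set_teq_trivial:
  assumes T: "re (\<lambda>e. T (e 0))" and R: "re (\<lambda>e. R (e 0) (e (Suc 0)))"
  shows "re_set (word_code ` {w. teq T R w []})"
proof -
  have "re (\<lambda>e. closure teq_ax (teq_rule T R) (e 0))"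
    by (rule re_closure; unfold teq_ax_def teq_rule_def)
      (intro re_intros re_subst1[OF T] re_subst2[OF R] rec_fn_append_code rec_fn_shift_code rec_fn_power_code)+
  from re_set_Collect[OF re_subst1[OF this, of "\<lambda>e. prod_encode (e 0, 0)"]]
  have "re_set {n. closure teq_ax (teq_rule T R) (prod_encode (n, 0))}"
    by (simp add: rec_fn_intros)
  moreover have "closure teq_ax (teq_rule T R) (prod_encode (n, 0)) \<longleftrightarrow> n \<in> word_code ` {w. teq T R w []}" for n
    using closure_teq_complete[of T R _ "[]"] closure_teq_sound[of T R "prod_encode (n, 0)"]
    by (auto simp: prod_encode_eq word_code_eq_iff simp flip: word_code_Nil)
  ultimately show ?thesis by simp
qed

section \<open>Presented groups\<close>

lemma peq_context: "peq Xs R u v \<Longrightarrow> peq Xs R (a @ u @ b) (a @ v @ b)"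
proof (induction rule: peq.induct)
  case (peq_cancel x u c v)
  then show ?case using peq.peq_cancel[of x Xs R "a @ u" c "v @ b"] by simp
next
  case (peq_rel r u v)
  then show ?case using peq.peq_rel[of r R Xs "a @ u" "v @ b"] by simp
next
  case (peq_trans u v w)
  then show ?case by (blast intro: peq.peq_trans)
qed (auto intro: peq.peq_refl peq.peq_sym)

lemma peq_append: "peq Xs R u u' \<Longrightarrow> peq Xs R v v' \<Longrightarrow> peq Xs R (u @ v) (u' @ v')"
  using peq_context[of Xs R u u' "[]" v] peq_context[of Xs R v v' u' "[]"]
  by (auto intro: peq_trans)

lemma peq_cancel_Nil: "x \<in> Xs \<Longrightarrow> peq Xs R [(x, b), (x, \<not> b)] []"
  using peq_cancel[of x Xs R "[]" b "[]"] by simp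

lemma words_append: "u @ v \<in> words Xs \<longleftrightarrow> u \<in> words Xs \<and> v \<in> words Xs"
  by (auto simp: words_def)

lemma words_Nil: "[] \<in> words Xs"
  by (simp add: words_def)

definition word_inv :: "word \<Rightarrow> word" where
  "word_inv w = rev (map (\<lambda>(x, b). (x, \<not> b)) w)"

lemma word_inv_words: "w \<in> words Xs \<Longrightarrow> word_inv w \<in> words Xs"
  by (auto simp: words_def word_inv_def)

lemma peq_word_inv: "w \<in> words Xs \<Longrightarrow> peq Xs R (word_inv w @ w) []"
proof (induction w)
  case Nil
  show ?case by (simp add: word_inv_def peq_refl)
next
  case (Cons l w)
  obtain x b where l: "l = (x, b)" by fastforce
  with Cons.prems have "x \<in> Xs" and w: "w \<in> words Xs" by (auto simp: words_def)
  \<comment> \<open>The two middle letters cancel; writing \<open>b\<close> as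
    \<open>\<not> \<not> b\<close> matches the form of \<open>peq_cancel\<close>.\<close>
  then have "peq Xs R (word_inv w @ [(x, \<not> b), (x, \<not> \<not> b)] @ w) (word_inv w @ w)"
    by (intro peq_cancel)
  with Cons.IH[OF w] show ?case by (auto simp: l word_inv_def intro: peq_trans)
qed

abbreviation wclass :: "nat set \<Rightarrow> word set \<Rightarrow> word \<Rightarrow> word set" where
  "wclass Xs R w \<equiv> grel Xs R `` {w}"

lemma equiv_grel: "equiv (words Xs) (grel Xs R)"
  by (rule equivI) (auto simp: refl_on_def sym_def trans_def grel_def intro: peq.peq_refl peq.peq_sym peq.peq_trans)

lemma wclass_eq_iff:
  "u \<in> words Xs \<Longrightarrow> v \<in> words Xs \<Longrightarrow> wclass Xs R u = wclass Xs R v \<longleftrightarrow> peq Xs R u v"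
  by (subst eq_equiv_class_iff[OF equiv_grel]) (auto simp: grel_def)

lemma carrier_presented_group: "carrier (presented_group (Xs, R)) = wclass Xs R ` words Xs"
  by (auto simp: presented_group_def quotient_def)

lemma one_presented_group: "\<one>\<^bsub>presented_group (Xs, R)\<^esub> = wclass Xs R []"
  by (simp add: presented_group_def)

text \<open>Multiplication chooses representatives by \<open>SOME\<close>; this compares the choice
  with a given representative and so makes the product well defined.\<close>

lemma some_wclass:
  assumes "w \<in> words Xs"
  shows "(SOME x. x \<in> wclass Xs R w) \<in> words Xs" "peq Xs R w (SOME x. x \<in> wclass Xs R w)"
proof -
  have "w \<in> wclass Xs R w" using assms by (simp add: grel_def peq_refl)
  then have "(SOME x. x \<in> wclass Xs R w) \<in> wclass Xs R w" by (rule someI)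
  then have "(w, SOME x. x \<in> wclass Xs R w) \<in> grel Xs R" by (simp only: Image_singleton_iff)
  then show "(SOME x. x \<in> wclass Xs R w) \<in> words Xs" "peq Xs R w (SOME x. x \<in> wclass Xs R w)"
    unfolding grel_def by blast+
qed

lemma mult_presented_group:
  assumes "u \<in> words Xs" "v \<in> words Xs"
  shows "wclass Xs R u \<otimes>\<^bsub>presented_group (Xs, R)\<^esub> wclass Xs R v = wclass Xs R (u @ v)"
  using some_wclass[OF assms(1), of R] some_wclass[OF assms(2), of R] assms
  by (simp add: presented_group_def wclass_eq_iff words_append peq_append peq_sym del: Image_singleton_iff)

lemma group_presented_group: "group (presented_group (Xs, R))"
proof (rule groupI)
  fix x assume "x \<in> carrier (presented_group (Xs, R))"
  then obtain w where "w \<in> words Xs" "x = wclass Xs R w" by (auto simp: carrier_presented_group)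
  then show "\<exists>y\<in>carrier (presented_group (Xs, R)). y \<otimes>\<^bsub>presented_group (Xs, R)\<^esub> x = \<one>\<^bsub>presented_group (Xs, R)\<^esub>"
    by (intro bexI[of _ "wclass Xs R (word_inv w)"])
      (auto simp: mult_presented_group one_presented_group carrier_presented_group word_inv_words
        wclass_eq_iff words_append words_Nil peq_word_inv)
qed (auto simp: carrier_presented_group one_presented_group mult_presented_group words_append words_Nil)

section \<open>Powers and torsion in presented groups\<close>

lemma wpow_0: "wpow w 0 = []"
  by (simp add: wpow_def)

lemma wpow_Suc: "wpow w (Suc n) = w @ wpow w n"
  by (simp add: wpow_def)

text \<open>Group powers are built by multiplication on the right, unlike
  \<open>wpow\<close>.\<close>

lemma wpow_Suc2: "wpow w (Suc n) = wpow w n @ w"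
  by (induction n) (simp_all add: wpow_def)

lemma wpow_words: "w \<in> words Xs \<Longrightarrow> wpow w n \<in> words Xs"
  by (induction n) (simp_all add: wpow_0 wpow_Suc words_Nil words_append)

lemma nat_pow_presented_group:
  "w \<in> words Xs \<Longrightarrow> wclass Xs R w [^]\<^bsub>presented_group (Xs, R)\<^esub> (n::nat) = wclass Xs R (wpow w n)"
  by (induction n)
    (simp_all add: nat_pow_def one_presented_group mult_presented_group wpow_0 wpow_Suc2 wpow_words)

text \<open>An element and its inverse are trivial together, so torsion depends only on absolute
  values of exponents.\<close>

lemma (in group) int_pow_eq_one_iff:
  "x \<in> carrier G \<Longrightarrow> x [^] (z::int) = \<one> \<longleftrightarrow> x [^] nat \<bar>z\<bar> = \<one>"
  by (auto simp: int_pow_def2 simp del: pow_nat)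

lemma torsion_free_presented_group:
  "torsion_free_on A (presented_group (Xs, R)) \<longleftrightarrow>
     (\<forall>w\<in>words Xs. \<forall>z\<in>A. peq Xs R (wpow w (nat \<bar>z\<bar>)) [] \<longrightarrow> peq Xs R w [])"
proof -
  interpret group "presented_group (Xs, R)" by (rule group_presented_group)
  have "wclass Xs R w [^]\<^bsub>presented_group (Xs, R)\<^esub> z = \<one>\<^bsub>presented_group (Xs, R)\<^esub> \<longleftrightarrow>
      peq Xs R (wpow w (nat \<bar>z\<bar>)) []" if "w \<in> words Xs" for w and z :: int
    using that by (subst int_pow_eq_one_iff)
      (simp_all del: pow_nat add: carrier_presented_group nat_pow_presented_group one_presented_group wclass_eq_iff wpow_words words_Nil)
  then show ?thesis
    unfolding torsion_free_on_def carrier_presented_group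
    by (auto simp: one_presented_group wclass_eq_iff words_Nil)
qed

lemma torsion_free_on_inj_hom:
  assumes "group G" "group H" "h \<in> hom H G" "inj_on h (carrier H)" "torsion_free_on A G"
  shows "torsion_free_on A H"
  unfolding torsion_free_on_def
proof (safe)
  interpret h: group_hom H G h
    using assms by (simp add: group_hom_def group_hom_axioms_def)
  fix g z assume g: "g \<in> carrier H" "g \<noteq> \<one>\<^bsub>H\<^esub>" and z: "z \<in> A" "g [^]\<^bsub>H\<^esub> z = \<one>\<^bsub>H\<^esub>"
  have "h g [^]\<^bsub>G\<^esub> z = \<one>\<^bsub>G\<^esub>"
    using h.hom_int_pow[OF g(1), of z] z(2) by simp
  moreover have "h g \<noteq> \<one>\<^bsub>G\<^esub>"
    using g inj_onD[OF assms(4), of g "\<one>\<^bsub>H\<^esub>"] by auto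
  ultimately show False
    using assms(5) g(1) z(1) unfolding torsion_free_on_def by auto
qed

section \<open>Retraction onto one copy\<close>

text \<open>A copy has all natural numbers as second components of its generators. Letters of copy
  \<open>i\<close> outside \<open>Xs\<close> are therefore deleted along with the other copies, so
  that the result is always a word over \<open>Xs\<close>.\<close>

definition word_retract :: "nat \<Rightarrow> nat set \<Rightarrow> word \<Rightarrow> word" where
  "word_retract i Xs w = map (\<lambda>(x, b). (psnd x, b)) (filter (\<lambda>(x, b). pfst x = i \<and> psnd x \<in> Xs) w)"

lemma word_retract_Nil: "word_retract i Xs [] = []"
  by (simp add: word_retract_def)

lemma word_retract_append: "word_retract i Xs (u @ v) = word_retract i Xs u @ word_retract i Xs v"
  by (simp add: word_retract_def)

lemma word_retract_words: "word_retract i Xs w \<in> words Xs"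
  by (auto simp: word_retract_def words_def)

lemma word_retract_wpow: "word_retract i Xs (wpow w n) = wpow (word_retract i Xs w) n"
  by (induction n) (simp_all add: wpow_0 wpow_Suc word_retract_append word_retract_Nil)

lemma word_retract_shift: "w \<in> words Xs \<Longrightarrow> word_retract i Xs (shift i w) = w"
  by (induction w) (auto simp: word_retract_def shift_def words_def)

lemma word_retract_shift_other: "j \<noteq> i \<Longrightarrow> word_retract i Xs (shift j w) = []"
  by (induction w) (auto simp: word_retract_def shift_def)

text \<open>Each rule of \<open>teq\<close> maps to a valid relation of the target: relators of copy
  \<open>i\<close> become members of \<open>R\<close>, those of other copies vanish, and the torsion
  rule holds because the target is torsion-free.\<close>

lemma peq_retract:
  assumes tf: "\<And>w n. w \<in> words Xs \<Longrightarrow> T n \<Longrightarrow> peq Xs R (wpow w n) [] \<Longrightarrow> peq Xs R w []"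
    and R: "R \<subseteq> words Xs" "\<And>r. S i (word_code r) \<Longrightarrow> r \<in> R"
  shows "teq T S u v \<Longrightarrow> peq Xs R (word_retract i Xs u) (word_retract i Xs v)"
proof (induction rule: teq.induct)
  case teq_Nil
  show ?case by (rule peq_refl)
next
  case (teq_sym u v)
  show ?case by (rule peq_sym[OF teq_sym.IH])
next
  case (teq_trans u v w)
  then show ?case by (blast intro: peq_trans)
next
  case (teq_Cons u v l)
  then show ?case
    using peq_append[OF peq_refl teq_Cons.IH, of "word_retract i Xs [l]"]
    by (simp flip: word_retract_append)
next
  case (teq_cancel x b w)
  \<comment> \<open>Deletion depends only on the generator, so both letters stay or both go.\<close>
  have "peq Xs R (word_retract i Xs [(x, b), (x, \<not> b)]) []"
    by (auto simp: word_retract_def peq_refl peq_cancel_Nil)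
  from peq_append[OF this peq_refl, of "word_retract i Xs w"] show ?case
    by (simp flip: word_retract_append)
next
  case (teq_rel j r w)
  have "peq Xs R (word_retract i Xs (shift j r)) []"
  proof (cases "j = i")
    case True
    with teq_rel R have "r \<in> R" "r \<in> words Xs" by auto
    then show ?thesis using peq_rel[of r R Xs "[]" "[]"] by (simp add: True word_retract_shift)
  qed (simp add: word_retract_shift_other peq_refl)
  from peq_append[OF this peq_refl, of "word_retract i Xs w"] show ?case
    by (simp add: word_retract_append)
next
  case (teq_tors n u w)
  then have "peq Xs R (wpow (word_retract i Xs u) n) []" by (simp add: word_retract_wpow word_retract_Nil)
  then have "peq Xs R (word_retract i Xs u) []" by (rule tf[OF word_retract_words teq_tors.hyps(1)])
  from peq_append[OF this peq_refl, of "word_retract i Xs w"] show ?case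
    by (simp add: word_retract_append)
qed

section \<open>The universal group and its embeddings\<close>

text \<open>Taking every trivial word as a relator presents exactly the quotient by
  \<open>teq\<close>: a relator or torsion step deletes a prefix that is itself trivial, hence a
  relator.\<close>

lemma peq_teq: "peq UNIV {w. teq T S w []} u v \<longleftrightarrow> teq T S u v"
proof
  show "peq UNIV {w. teq T S w []} u v \<Longrightarrow> teq T S u v"
  proof (induction rule: peq.induct)
    case (peq_cancel x u b v)
    show ?case using teq_append_left[OF teq_cancel[of T S x b v], of u] by simp
  next
    case (peq_rel r u v)
    then show ?case using teq_append_left[OF teq_append_right[of T S r "[]" v], of u] by simp
  next
    case (peq_trans u v w)
    then show ?case by (blast intro: teq_trans)
  qed (auto intro: teq_refl teq_sym)
next
  show "teq T S u v \<Longrightarrow> peq UNIV {w. teq T S w []} u v"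
  proof (induction rule: teq.induct)
    case (teq_trans u v w)
    then show ?case by (blast intro: peq_trans)
  next
    case (teq_Cons u v l)
    from peq_context[OF this(2), of "[l]" "[]"] show ?case by simp
  next
    case (teq_cancel x b w)
    show ?case using peq_cancel[of x UNIV _ "[]" b w] by simp
  next
    case (teq_rel i r w)
    then have "teq T S (shift i r) []" using teq.teq_rel[of S i r T "[]"] by simp
    then show ?case using peq_rel[of "shift i r" "{w. teq T S w []}" UNIV "[]" w] by simp
  next
    case (teq_tors n u w)
    then have "teq T S u []" using teq.teq_tors[of T n S u "[]"] by simp
    then show ?case using peq_rel[of u "{w. teq T S w []}" UNIV "[]" w] by simp
  qed (auto intro: peq_refl peq_sym)
qed

lemma shift_Cons: "shift i ((x, b) # w) = (prod_encode (i, x), b) # shift i w"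
  by (simp add: shift_def)

lemma shift_append: "shift i (u @ v) = shift i u @ shift i v"
  by (simp add: shift_def)

lemma teq_shift:
  assumes "\<And>r. r \<in> R \<Longrightarrow> S i (word_code r)"
  shows "peq Xs R u v \<Longrightarrow> teq T S (shift i u) (shift i v)"
proof (induction rule: peq.induct)
  case (peq_cancel x u b v)
  show ?case
    using teq_append_left[OF teq_cancel[of T S "prod_encode (i, x)" b "shift i v"], of "shift i u"]
    by (simp add: shift_append shift_Cons)
next
  case (peq_rel r u v)
  then show ?case
    using teq_append_left[OF teq_rel[of S i r T "shift i v"], of "shift i u"] assms
    by (simp add: shift_append)
next
  case (peq_trans u v w)
  then show ?case by (blast intro: teq_trans)
qed (auto intro: teq_refl teq_sym)

text \<open>The embedding is induced by \<open>shift i\<close>. It is injective because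
  \<open>word_retract i Xs\<close> respects the congruences and is a left inverse of
  \<open>shift i\<close> on words over \<open>Xs\<close>.\<close>

lemma embeds_into_teq_group:
  assumes "torsion_free_on A (presented_group (Xs, R))" "R \<subseteq> words Xs"
    and T: "\<And>n. T n \<longleftrightarrow> (\<exists>z\<in>A. n = nat \<bar>z\<bar>)"
    and S: "\<And>r. r \<in> R \<longleftrightarrow> S i (word_code r)"
  shows "embeds_into (presented_group (Xs, R)) (presented_group (UNIV, {w. teq T S w []}))"
proof -
  let ?Q = "{w. teq T S w []}"
  define h where "h c = wclass UNIV ?Q (shift i (SOME w. w \<in> c))" for c
  have UN: "w \<in> words UNIV" for w by (simp add: words_def)
  have h: "h (wclass Xs R w) = wclass UNIV ?Q (shift i w)" if "w \<in> words Xs" for w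
  proof -
    have "teq T S (shift i w) (shift i (SOME x. x \<in> wclass Xs R w))"
      using S by (intro teq_shift[OF _ some_wclass(2)[OF that]]) auto
    then show ?thesis
      unfolding h_def by (auto simp: wclass_eq_iff UN peq_teq intro: teq_sym)
  qed
  have "h \<in> hom (presented_group (Xs, R)) (presented_group (UNIV, ?Q))"
    by (rule homI)
      (auto simp: carrier_presented_group mult_presented_group h UN words_append shift_append)
  moreover have "inj_on h (carrier (presented_group (Xs, R)))"
  proof (rule inj_onI)
    fix a b assume "a \<in> carrier (presented_group (Xs, R))" "b \<in> carrier (presented_group (Xs, R))"
      and eq: "h a = h b"
    then obtain u v where u: "u \<in> words Xs" "a = wclass Xs R u" and v: "v \<in> words Xs" "b = wclass Xs R v"
      by (auto simp: carrier_presented_group)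
    with eq have "teq T S (shift i u) (shift i v)"
      by (simp add: h wclass_eq_iff UN peq_teq)
    moreover have "peq Xs R w []" if "w \<in> words Xs" "T n" "peq Xs R (wpow w n) []" for w n
      using assms(1) that by (auto simp: torsion_free_presented_group T)
    ultimately have "peq Xs R (word_retract i Xs (shift i u)) (word_retract i Xs (shift i v))"
      using assms(2) S by (intro peq_retract[where T = T and S = S]) auto
    then show "a = b" using u v by (simp add: word_retract_shift wclass_eq_iff)
  qed
  ultimately show ?thesis unfolding embeds_into_def by blast
qed

section \<open>Enumerability of the torsion exponents\<close>

lemma re_abs_int_set:
  assumes "re_int_set A"
  shows "re (\<lambda>e. \<exists>z\<in>A. e 0 = nat \<bar>z\<bar>)"
proof -
  obtain a where a: "\<And>n. n \<in> int_encode ` A \<longleftrightarrow> W a n"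
    using assms unfolding re_int_set_def by (rule re_set_index) (rule that)
  have mem: "z \<in> A \<longleftrightarrow> W a (int_encode z)" for z
    using a[of "int_encode z"] by (auto simp: inj_image_mem_iff[OF inj_int_encode])
  \<comment> \<open>Nonnegative integers have even codes and negative ones odd codes.\<close>
  have pos: "int_encode (int m) = m + m" for m
    by (simp add: int_encode_def sum_encode_def)
  have neg: "int_encode (- int (Suc k)) = Suc (k + k)" for k
    by (simp add: int_encode_def sum_encode_def)
  have "(\<exists>z\<in>A. m = nat \<bar>z\<bar>) \<longleftrightarrow> W a (m + m) \<or> (\<exists>k. m = Suc k \<and> W a (Suc (k + k)))" for m
  proof -
    have "(\<exists>z\<in>A. m = nat \<bar>z\<bar>) \<longleftrightarrow> int m \<in> A \<or> - int m \<in> A"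
    proof -
      have "m = nat \<bar>z\<bar> \<longleftrightarrow> z = int m \<or> z = - int m" for z by arith
      then show ?thesis by auto
    qed
    \<comment> \<open>The code formula for negatives requires a successor; for \<open>m = 0\<close>
      both disjuncts coincide, and the first one covers it.\<close>
    also have "\<dots> \<longleftrightarrow> int m \<in> A \<or> (\<exists>k. m = Suc k \<and> - int (Suc k) \<in> A)"
      by (cases m) auto
    finally show ?thesis by (simp only: mem pos neg)
  qed
  then show ?thesis by (simp only:) (intro re_intros re_W)
qed

theorem theorem2p9:
  fixes A :: "int set"
  assumes "re_int_set A"
  shows "\<exists>Q. cg_rec_presentation Q \<and> torsion_free_on A (presented_group Q) \<and>
    (\<forall>P. cg_rec_presentation P \<and> torsion_free_on A (presented_group P)
         \<longrightarrow> embeds_into (presented_group P) (presented_group Q)) \<and>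
    (\<forall>G :: ('g, 'b) monoid_scheme. group G \<and> cg_rec_presentable G \<and> torsion_free_on A G
         \<longrightarrow> embeds_into G (presented_group Q))"
proof -
  define T where "T n \<longleftrightarrow> (\<exists>z\<in>A. n = nat \<bar>z\<bar>)" for n
  define R where "R = {w. teq T W w []}"
  have "re (\<lambda>e. T (e 0))"
    unfolding T_def using assms by (rule re_abs_int_set)
  then have "re_set (word_code ` R)"
    unfolding R_def by (intro re_set_teq_trivial re_W rec_fn_intros)
  moreover have "re_set UNIV"
    using re_set_Collect[of "\<lambda>_. True"] re_dec[OF dec_const] by simp
  ultimately have Q: "cg_rec_presentation (UNIV, R)"
    by (simp add: cg_rec_presentation_def words_def)
  have tf: "torsion_free_on A (presented_group (UNIV, R))"
  proof -
    \<comment> \<open>This is the torsion rule with an empty remainder.\<close>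
    have "teq T W w []" if "z \<in> A" "teq T W (wpow w (nat \<bar>z\<bar>)) []" for w z
      using teq_tors[of T "nat \<bar>z\<bar>" W w "[]"] that by (auto simp: T_def)
    then show ?thesis by (auto simp: torsion_free_presented_group R_def peq_teq)
  qed
  have embeds: "embeds_into (presented_group P) (presented_group (UNIV, R))"
    if P: "cg_rec_presentation P" "torsion_free_on A (presented_group P)" for P
  proof -
    obtain Xs S where P_eq: "P = (Xs, S)" by (cases P)
    with P(1) have S: "re_set (word_code ` S)" "S \<subseteq> words Xs" by (auto simp: cg_rec_presentation_def)
    from S(1) obtain i where i: "\<And>n. n \<in> word_code ` S \<longleftrightarrow> W i n" by (rule re_set_index) (rule that)
    have "r \<in> S \<longleftrightarrow> W i (word_code r)" for r
      unfolding i[symmetric] by (auto simp: word_code_eq_iff)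
    then show ?thesis
      unfolding R_def P_eq using P(2) S(2) by (intro embeds_into_teq_group[where i = i]) (auto simp: P_eq T_def)
  qed
  have "embeds_into G (presented_group (UNIV, R))"
    if G: "group G" "cg_rec_presentable G" "torsion_free_on A G" for G :: "('g, 'b) monoid_scheme"
  proof -
    obtain P where P: "cg_rec_presentation P" "G \<cong> presented_group P"
      using G(2) unfolding cg_rec_presentable_def by blast
    have grp: "group (presented_group P)" by (cases P) (simp add: group_presented_group)
    from P(2) obtain f where f: "f \<in> iso G (presented_group P)" by (auto simp: is_iso_def)
    \<comment> \<open>The inverse isomorphism embeds the presented group into \<open>G\<close> and
      so carries torsion-freeness over to it.\<close>
    from group.iso_sym[OF G(1) P(2)] obtain g where "g \<in> iso (presented_group P) G"
      by (auto simp: is_iso_def)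
    then have "torsion_free_on A (presented_group P)"
      using torsion_free_on_inj_hom[OF G(1) grp, of g A] G(3) by (auto simp: iso_def bij_betw_def)
    from embeds[OF P(1) this] obtain h where
      "h \<in> hom (presented_group P) (presented_group (UNIV, R))" "inj_on h (carrier (presented_group P))"
      by (auto simp: embeds_into_def)
    with f have "h \<circ> f \<in> hom G (presented_group (UNIV, R))" "inj_on (h \<circ> f) (carrier G)"
      by (auto simp: iso_def bij_betw_def intro: Group.hom_compose comp_inj_on)
    then show ?thesis unfolding embeds_into_def by blast
  qed
  with Q tf embeds show ?thesis by blast
qed

end
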